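(* Let the response process and the adaptive $p$-step-ahead algorithm be as described in the context, with true parameter point $\overline\theta\in\Theta$, arbitrary adaptive estimators $\widehat\theta_k$ employed by the algorithm, and adaptive least squares estimators $\widehat\theta_k^{(\mathrm{LS})}$. Assume that the following hold. (a1) There is a nondecreasing sequence $\mathcal F_0\subseteq\mathcal F_1\subseteq\cdots$ of sub-sigma-fields of $\mathcal F$ such that for each $k\in\mathbb N$ the random vector $\boldsymbol X_k=(X_{n_{k-1}+1},\ldots,X_{n_k})$ is $\mathcal F_{k-1}$-measurable and $\boldsymbol Y_k=(Y_{n_{k-1}+1},\ldots,Y_{n_k})^{T}$ is $\mathcal F_k$-measurable. (a2) $Y_i=\mu(X_i,\overline\theta)+e_i$ for all $i\in\mathbb N$, with real-valued square integrable random errors $e_i$ such that, with $\boldsymbol e_k=(e_{n_{k-1}+1},\ldots,e_{n_k})^{T}$, one has $\mathrm E(\boldsymbol e_k\mid\mathcal F_{k-1})=0$ a.s. for all $k\in\mathbb N$ and $\sup_{k\in\mathbb N}\mathrm E(\|\boldsymbol e_k\|^2\mid\mathcal F_{k-1})<\infty$ a.s. Assume moreover that at least one of the following two conditions holds. (SI) For all pairwise distinct points $z_1,\ldots,z_p\in\mathcal X$ the map $\theta\mapsto(\mu(z_1,\theta),\ldots,\mu(z_p,\theta))^{T}$ from $\Theta$ to $\mathbb R^p$ is injective. (GLM$^*$) There are continuous functions $\psi:\mathcal X\times\Theta\to(0,\infty)$ and $f:\mathcal X\to\mathbb R^p$ with $f_\theta(x)=\psi(x,\theta)f(x)$ for all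 $(x,\theta)\in\mathcal X\times\Theta$; moreover $\Theta\subseteq\mathbb R^p$ (with the Euclidean metric), and $\mu(x,\theta)=G(f^{T}(x)\,\theta)$ for all $(x,\theta)$, where $G:I\to\mathbb R$ is a continuously differentiable function on an open interval $I\subseteq\mathbb R$ with $G'>0$, and $f^{T}(x)\,\theta\in I$ for all $(x,\theta)\in\mathcal X\times\Theta$. Then $\widehat\theta_k^{(\mathrm{LS})}\to\overline\theta$ almost surely as $k\to\infty$.
   Context: Setting: $p\in\mathbb N$; $\mathcal X$ (experimental region) and $\Theta$ (parameter space) are compact metric spaces; $\mu:\mathcal X\times\Theta\to\mathbb R$ is continuous; $f_\theta:\mathcal X\to\mathbb R^p$, $\theta\in\Theta$, is a family of functions such that $(x,\theta)\mapsto f_\theta(x)$ is continuous on $\mathcal X\times\Theta$ and, for each $\theta\in\Theta$, the image $f_\theta(\mathcal X)$ spans $\mathbb R^p$. Vectors are column vectors, $\|\cdot\|$ is the Euclidean norm. Process and algorithm: $X_i$ and $Y_i$, $i\in\mathbb N$, are random variables on a probability space $(\Omega,\mathcal F,\mathbb P_{\overline\theta})$ with values in $\mathcal X$ and $\mathbb R$, respectively, where $\overline\theta\in\Theta$ is the true parameter point. Let $n_1\in\mathbb N$, $n_0:=0$, and $n_k:=n_1+(k-1)p$ for $k\ge1$. The adaptive estimators employed by the algorithm are arbitrary $\Theta$-valued estimators $\widehat\theta_k=\widehat\theta_k(X_1,Y_1,\ldots,X_{n_k},Y_{n_k})$, $k\ge1$. The points $X_1,\ldots,X_{n_1}$ are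 arbitrary initial design points, and the $p$-step-ahead algorithm chooses the subsequent points so that for every $k\ge1$ (pathwise) $$\bigl(\det[f_{\widehat\theta_k}(X_{n_k+1}),\ldots,f_{\widehat\theta_k}(X_{n_k+p})]\bigr)^2=\max_{z_1,\ldots,z_p\in\mathcal X}\bigl(\det[f_{\widehat\theta_k}(z_1),\ldots,f_{\widehat\theta_k}(z_p)]\bigr)^2 .$$ The adaptive least squares estimator $\widehat\theta_k^{(\mathrm{LS})}=\widehat\theta_k^{(\mathrm{LS})}(X_1,Y_1,\ldots,X_{n_k},Y_{n_k})$, $k\ge1$, is a $\Theta$-valued random variable that (pathwise) minimizes $\sum_{i=1}^{n_k}(Y_i-\mu(X_i,\theta))^2$ over $\theta\in\Theta$. It need not coincide with $\widehat\theta_k$. *)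

theory Defs
  imports "HOL-Probability.Probability"
begin

text \<open>
  The dimension \<open>p\<close> is \<open>CARD('p)\<close>. The experimental region and the parameter space are
  compact subsets of arbitrary metric spaces. Sequences are indexed from 1;
  the values \<open>X 0\<close>, \<open>Y 0\<close>, \<open>e 0\<close> and those of the estimators at \<open>k = 0\<close> are irrelevant.
\<close>

definition sample_size :: "nat \<Rightarrow> nat \<Rightarrow> nat \<Rightarrow> nat" where
  "sample_size n1 p k = (if k = 0 then 0 else n1 + (k - 1) * p)"

abbreviation stage_block :: "nat \<Rightarrow> nat \<Rightarrow> nat \<Rightarrow> nat set" where
  "stage_block n1 p k \<equiv> {sample_size n1 p (k - 1) + 1 .. sample_size n1 p k}"

definition det_sq :: "('p::finite \<Rightarrow> real ^ 'p) \<Rightarrow> real" where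
  "det_sq v = (det (\<chi> i j. v j $ i))\<^sup>2"

text \<open>
  A numbering \<open>1, \<dots>, p\<close> of the columns. It is only applied inside \<open>det_sq\<close>, which is
  invariant under permutations of the columns, so the choice does not matter.
\<close>

definition col_number :: "'p::finite \<Rightarrow> nat" where
  "col_number = (SOME b. bij_betw b (UNIV :: 'p set) {1..CARD('p)})"

lemma bij_betw_col_number: "bij_betw col_number (UNIV :: 'p::finite set) {1..CARD('p)}"
proof -
  have "\<exists>b. bij_betw b (UNIV :: 'p set) {1..CARD('p)}"
    by (rule finite_same_card_bij) auto
  then show ?thesis
    unfolding col_number_def by (rule someI_ex)
qed

lemma det_sq_permute:
  fixes v :: "'p::finite \<Rightarrow> real ^ 'p"
  assumes "bij \<pi>"
  shows "det_sq (v \<circ> \<pi>) = det_sq v"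
proof -
  have "\<pi> permutes UNIV"
    using assms unfolding permutes_def bij_iff by simp
  then have "det (\<chi> i j. (\<chi> i j. v j $ i :: real ^ 'p ^ 'p) $ i $ \<pi> j)
      = of_int (sign \<pi>) * det (\<chi> i j. v j $ i :: real ^ 'p ^ 'p)"
    by (rule det_permute_columns)
  then show ?thesis
    by (simp add: det_sq_def power_mult_distrib sign_def)
qed

text \<open>
  A \<open>\<Theta>\<close>-valued random variable that is a function of the first \<open>n\<close> observations.
\<close>

definition estimator ::
  "'w measure \<Rightarrow> 'th::metric_space set \<Rightarrow> (nat \<Rightarrow> 'w \<Rightarrow> 'x) \<Rightarrow> (nat \<Rightarrow> 'w \<Rightarrow> real)
    \<Rightarrow> nat \<Rightarrow> ('w \<Rightarrow> 'th) \<Rightarrow> bool" where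
  "estimator M \<Theta> X Y n T \<longleftrightarrow>
     T \<in> M \<rightarrow>\<^sub>M borel \<and> (\<forall>\<omega>\<in>space M. T \<omega> \<in> \<Theta>) \<and>
     (\<exists>g. \<forall>\<omega>\<in>space M. T \<omega> = g (\<lambda>i\<in>{1..n}. (X i \<omega>, Y i \<omega>)))"

definition p_step_ahead ::
  "'w measure \<Rightarrow> 'x set \<Rightarrow> ('th \<Rightarrow> 'x \<Rightarrow> real ^ 'p) \<Rightarrow> nat
    \<Rightarrow> (nat \<Rightarrow> 'w \<Rightarrow> 'x) \<Rightarrow> (nat \<Rightarrow> 'w \<Rightarrow> 'th) \<Rightarrow> bool" where
  "p_step_ahead M \<X> f n1 X T \<longleftrightarrow>
     (\<forall>k\<ge>1. \<forall>\<omega>\<in>space M. \<forall>z :: 'p::finite \<Rightarrow> 'x. (\<forall>j. z j \<in> \<X>) \<longrightarrow>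
        det_sq (\<lambda>j. f (T k \<omega>) (z j)) \<le>
        det_sq (\<lambda>j::'p. f (T k \<omega>) (X (sample_size n1 CARD('p) k + col_number j) \<omega>)))"

definition least_squares ::
  "'w measure \<Rightarrow> 'th set \<Rightarrow> ('x \<Rightarrow> 'th \<Rightarrow> real) \<Rightarrow> (nat \<Rightarrow> 'w \<Rightarrow> 'x) \<Rightarrow> (nat \<Rightarrow> 'w \<Rightarrow> real)
    \<Rightarrow> nat \<Rightarrow> ('w \<Rightarrow> 'th) \<Rightarrow> bool" where
  "least_squares M \<Theta> \<mu> X Y n T \<longleftrightarrow>
     (\<forall>\<omega>\<in>space M. \<forall>\<theta>\<in>\<Theta>.
        (\<Sum>i=1..n. (Y i \<omega> - \<mu> (X i \<omega>) (T \<omega>))\<^sup>2) \<le> (\<Sum>i=1..n. (Y i \<omega> - \<mu> (X i \<omega>) \<theta>)\<^sup>2))"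

text \<open>
  The vectors of stage \<open>k\<close> are families indexed by the block of observation numbers, since
  their dimension (\<open>n1\<close> for \<open>k = 1\<close>, otherwise \<open>p\<close>) depends on \<open>k\<close>.
\<close>

definition cond_a1 ::
  "'w measure \<Rightarrow> (nat \<Rightarrow> 'w measure) \<Rightarrow> nat \<Rightarrow> nat
    \<Rightarrow> (nat \<Rightarrow> 'w \<Rightarrow> 'x::metric_space) \<Rightarrow> (nat \<Rightarrow> 'w \<Rightarrow> real) \<Rightarrow> bool" where
  "cond_a1 M F n1 p X Y \<longleftrightarrow>
     (\<forall>k. subalgebra M (F k)) \<and> (\<forall>k. sets (F k) \<subseteq> sets (F (Suc k))) \<and>
     (\<forall>k\<ge>1. (\<lambda>\<omega>. \<lambda>i\<in>stage_block n1 p k. X i \<omega>)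
              \<in> F (k - 1) \<rightarrow>\<^sub>M PiM (stage_block n1 p k) (\<lambda>_. borel)) \<and>
     (\<forall>k\<ge>1. (\<lambda>\<omega>. \<lambda>i\<in>stage_block n1 p k. Y i \<omega>)
              \<in> F k \<rightarrow>\<^sub>M PiM (stage_block n1 p k) (\<lambda>_. borel))"

text \<open>The conditional expectation of a random vector is taken componentwise.\<close>

definition cond_a2 ::
  "'w measure \<Rightarrow> (nat \<Rightarrow> 'w measure) \<Rightarrow> nat \<Rightarrow> nat \<Rightarrow> ('x \<Rightarrow> 'th \<Rightarrow> real) \<Rightarrow> 'th
    \<Rightarrow> (nat \<Rightarrow> 'w \<Rightarrow> 'x) \<Rightarrow> (nat \<Rightarrow> 'w \<Rightarrow> real) \<Rightarrow> (nat \<Rightarrow> 'w \<Rightarrow> real) \<Rightarrow> bool" where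
  "cond_a2 M F n1 p \<mu> \<theta>bar X Y e \<longleftrightarrow>
     (\<forall>i\<ge>1. \<forall>\<omega>\<in>space M. Y i \<omega> = \<mu> (X i \<omega>) \<theta>bar + e i \<omega>) \<and>
     (\<forall>i\<ge>1. e i \<in> borel_measurable M \<and> integrable M (\<lambda>\<omega>. (e i \<omega>)\<^sup>2)) \<and>
     (\<forall>k\<ge>1. AE \<omega> in M. \<forall>i\<in>stage_block n1 p k. real_cond_exp M (F (k - 1)) (e i) \<omega> = 0) \<and>
     (AE \<omega> in M. bdd_above
        ((\<lambda>k. real_cond_exp M (F (k - 1)) (\<lambda>\<omega>'. \<Sum>i\<in>stage_block n1 p k. (e i \<omega>')\<^sup>2) \<omega>) ` {1..}))"

definition cond_SI ::
  "'p::finite itself \<Rightarrow> 'x set \<Rightarrow> 'th set \<Rightarrow> ('x \<Rightarrow> 'th \<Rightarrow> real) \<Rightarrow> bool" where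
  "cond_SI _ \<X> \<Theta> \<mu> \<longleftrightarrow>
     (\<forall>z :: 'p \<Rightarrow> 'x. inj z \<and> (\<forall>j. z j \<in> \<X>) \<longrightarrow>
        inj_on (\<lambda>\<theta>. (\<chi> j. \<mu> (z j) \<theta>) :: real ^ 'p) \<Theta>)"

text \<open>
  The requirement that \<open>\<Theta>\<close> is a subset of \<open>\<real>\<^sup>p\<close> with the Euclidean metric is expressed by the
  isometric embedding \<open>\<iota>\<close>; for \<open>'th = real ^ 'p\<close> it can be taken as the identity.
\<close>

definition cond_GLM_star ::
  "'x::metric_space set \<Rightarrow> 'th::metric_space set \<Rightarrow> ('x \<Rightarrow> 'th \<Rightarrow> real)
    \<Rightarrow> ('th \<Rightarrow> 'x \<Rightarrow> real ^ 'p::finite) \<Rightarrow> bool" where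
  "cond_GLM_star \<X> \<Theta> \<mu> f \<longleftrightarrow>
     (\<exists>(\<psi> :: 'x \<Rightarrow> 'th \<Rightarrow> real) (h :: 'x \<Rightarrow> real ^ 'p) (\<iota> :: 'th \<Rightarrow> real ^ 'p)
        (G :: real \<Rightarrow> real) (I :: real set).
        continuous_on (\<X> \<times> \<Theta>) (\<lambda>(x, \<theta>). \<psi> x \<theta>) \<and>
        (\<forall>x\<in>\<X>. \<forall>\<theta>\<in>\<Theta>. 0 < \<psi> x \<theta>) \<and>
        continuous_on \<X> h \<and>
        (\<forall>x\<in>\<X>. \<forall>\<theta>\<in>\<Theta>. f \<theta> x = \<psi> x \<theta> *\<^sub>R h x) \<and>
        (\<forall>\<theta>\<in>\<Theta>. \<forall>\<theta>'\<in>\<Theta>. dist (\<iota> \<theta>) (\<iota> \<theta>') = dist \<theta> \<theta>') \<and>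
        open I \<and> is_interval I \<and>
        G C1_differentiable_on I \<and> (\<forall>t\<in>I. 0 < deriv G t) \<and>
        (\<forall>x\<in>\<X>. \<forall>\<theta>\<in>\<Theta>. h x \<bullet> \<iota> \<theta> \<in> I \<and> \<mu> x \<theta> = G (h x \<bullet> \<iota> \<theta>)))"

end

theory Submission
  imports Defs "HOL-Library.Discrete_Functions"
begin

text \<open>
  Consistency follows from two facts. First, the errors average out uniformly over the parameter
  space: writing \<open>h(x,\<theta>) = \<mu>(x,\<theta>bar) - \<mu>(x,\<theta>)\<close>, almost surely the sum of \<open>h(X\<^sub>i,\<theta>) e\<^sub>i\<close> over the
  observations of the first \<open>n\<close> stages is \<open>o(n)\<close>, uniformly in \<open>\<theta>\<close>. Secondly, every stage after
  the initial one separates \<open>\<theta>bar\<close> from all parameters at distance at least \<open>\<epsilon>\<close>: the sum of \<open>h(X\<^sub>i,\<theta>)\<^sup>2\<close> over the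
  stage is at least some \<open>c > 0\<close>. Comparing the residual sum of squares at the least squares
  estimate with that at \<open>\<theta>bar\<close> bounds the sum of \<open>h(X\<^sub>i,\<theta>)\<^sup>2\<close> at the estimate by
  twice the absolute value of the error sum, so the estimate cannot stay away from \<open>\<theta>bar\<close>
  (\<open>least_squares_converges\<close>).

  For the first fact, with \<open>\<theta>\<close> fixed, the sums of \<open>h(X\<^sub>i,\<theta>) e\<^sub>i\<close> over the stages are martingale differences
  with conditional second moments that are bounded almost surely. Truncation by these moments
  reduces their strong law to that of uncorrelated variables with bounded variances
  (\<open>strong_law_uncorrelated\<close>, \<open>strong_law_centered_by_cond_exp\<close>). By compactness the functions
  \<open>h(\<cdot>,\<theta>)\<close> have finite nets in the supremum norm, and the same strong law shows that
  the averages of \<open>\<bar>e\<^sub>i\<bar>\<close> are almost surely bounded; together these give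
  uniformity (\<open>uniform_averages_small\<close>).

  The second fact is a compactness argument: whatever parameter the algorithm uses, the points of
  a stage maximize a determinant whose maximum is not zero, and either of the two model
  assumptions then makes the responses at these points determine the parameter
  (\<open>maximal_design_contrast_bounded_below\<close>).
\<close>

section \<open>A strong law for uncorrelated variables\<close>

text \<open>
  The monotone convergence form of the Borel-Cantelli argument: if the expectations are
  summable, then so are almost all paths.
\<close>

lemma AE_tendsto_zero_if_summable_integral:
  fixes f :: "nat \<Rightarrow> 'a \<Rightarrow> real"
  assumes int: "\<And>n. integrable M (f n)"
    and nonneg: "\<And>n x. 0 \<le> f n x"
    and sm: "summable (\<lambda>n. \<integral>x. f n x \<partial>M)"
  shows "AE x in M. (\<lambda>n. f n x) \<longlonglongrightarrow> 0"
proof -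
  have [measurable]: "f n \<in> borel_measurable M" for n
    using int by auto
  have "(\<integral>\<^sup>+x. (\<Sum>n. ennreal (f n x)) \<partial>M) = (\<Sum>n. \<integral>\<^sup>+x. ennreal (f n x) \<partial>M)"
    by (rule nn_integral_suminf) auto
  also have "\<dots> = (\<Sum>n. ennreal (\<integral>x. f n x \<partial>M))"
    using int nonneg by (intro suminf_cong nn_integral_eq_integral) auto
  also have "\<dots> = ennreal (\<Sum>n. \<integral>x. f n x \<partial>M)"
    using sm nonneg by (intro suminf_ennreal2) auto
  finally have "AE x in M. (\<Sum>n. ennreal (f n x)) \<noteq> \<infinity>"
    by (intro nn_integral_PInf_AE) auto
  then show ?thesis
  proof eventually_elim
    case (elim x)
    then have "summable (\<lambda>n. f n x)"
      using nonneg by (intro summable_suminf_not_top) (auto simp: infinity_ennreal_def)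
    then show ?case
      by (rule summable_LIMSEQ_zero)
  qed
qed

lemma integrable_mult_of_square_integrable:
  fixes f g :: "'a \<Rightarrow> real"
  assumes [measurable]: "f \<in> borel_measurable M" "g \<in> borel_measurable M"
    and "integrable M (\<lambda>x. (f x)\<^sup>2)" "integrable M (\<lambda>x. (g x)\<^sup>2)"
  shows "integrable M (\<lambda>x. f x * g x)"
proof (rule Bochner_Integration.integrable_bound)
  show "integrable M (\<lambda>x. (f x)\<^sup>2 + (g x)\<^sup>2)"
    using assms by simp
  have "\<bar>a * b\<bar> \<le> a\<^sup>2 + b\<^sup>2" for a b :: real
  proof -
    have "0 \<le> (\<bar>a\<bar> - \<bar>b\<bar>)\<^sup>2" by simp
    then have "2 * \<bar>a * b\<bar> \<le> a\<^sup>2 + b\<^sup>2"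
      by (simp add: power2_diff abs_mult)
    then show ?thesis by simp
  qed
  then show "AE x in M. norm (f x * g x) \<le> norm ((f x)\<^sup>2 + (g x)\<^sup>2)"
    by simp
qed auto

lemma square_integrable_sum:
  fixes f :: "'i \<Rightarrow> 'a \<Rightarrow> real"
  assumes "\<And>i. i \<in> A \<Longrightarrow> f i \<in> borel_measurable M"
    and "\<And>i. i \<in> A \<Longrightarrow> integrable M (\<lambda>x. (f i x)\<^sup>2)"
  shows "integrable M (\<lambda>x. (\<Sum>i\<in>A. f i x)\<^sup>2)"
  unfolding power2_eq_square sum_product
  by (intro Bochner_Integration.integrable_sum integrable_mult_of_square_integrable)
    (use assms in auto)

lemma integral_square_sum_uncorrelated:
  fixes D :: "nat \<Rightarrow> 'a \<Rightarrow> real"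
  assumes meas: "\<And>k. D k \<in> borel_measurable M"
    and sq: "\<And>k. integrable M (\<lambda>x. (D k x)\<^sup>2)"
    and orth: "\<And>j k. j < k \<Longrightarrow> (\<integral>x. D j x * D k x \<partial>M) = 0"
    and bound: "\<And>k. (\<integral>x. (D k x)\<^sup>2 \<partial>M) \<le> N"
    and fin: "finite A"
  shows "(\<integral>x. (\<Sum>k\<in>A. D k x)\<^sup>2 \<partial>M) \<le> N * card A"
proof -
  have int: "integrable M (\<lambda>x. D j x * D k x)" for j k
    by (rule integrable_mult_of_square_integrable[OF meas meas sq sq])
  have "(\<integral>x. (\<Sum>k\<in>A. D k x)\<^sup>2 \<partial>M) = (\<integral>x. (\<Sum>j\<in>A. \<Sum>k\<in>A. D j x * D k x) \<partial>M)"
    by (simp add: power2_eq_square sum_product)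
  also have "\<dots> = (\<Sum>j\<in>A. \<Sum>k\<in>A. \<integral>x. D j x * D k x \<partial>M)"
    by (simp add: int)
  also have "\<dots> = (\<Sum>j\<in>A. \<Sum>k\<in>A. if k = j then \<integral>x. (D j x)\<^sup>2 \<partial>M else 0)"
  proof (intro sum.cong refl)
    fix j k
    show "(\<integral>x. D j x * D k x \<partial>M) = (if k = j then \<integral>x. (D j x)\<^sup>2 \<partial>M else 0)"
      using orth[of j k] orth[of k j]
      by (cases j k rule: linorder_cases) (auto simp: power2_eq_square mult.commute)
  qed
  also have "\<dots> = (\<Sum>j\<in>A. \<integral>x. (D j x)\<^sup>2 \<partial>M)"
    using fin by (simp add: sum.delta)
  also have "\<dots> \<le> (\<Sum>j\<in>A. N)"
    by (intro sum_mono bound)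
  finally show ?thesis
    by (simp add: mult.commute)
qed

text \<open>
  Rajchman's strong law, for variables that are orthogonal in \<open>L\<^sup>2\<close>; for centered variables
  this is uncorrelatedness. The partial sums over \<open>k < m\<^sup>2\<close> have second moment at most
  \<open>N m\<^sup>2\<close>, so divided by \<open>m\<^sup>2\<close> they have summable second moments. Between consecutive squares there are only
  \<open>2m + 1\<close> positions, and each remaining partial sum has second moment at most \<open>2 N m\<close>;
  hence even the sum of the squares of all of them, divided by \<open>m\<^sup>4\<close>, has an expectation of order
  \<open>m\<^sup>-\<^sup>2\<close>. No maximal inequality is needed.
\<close>

theorem strong_law_uncorrelated:
  fixes D :: "nat \<Rightarrow> 'a \<Rightarrow> real"
  assumes meas: "\<And>k. D k \<in> borel_measurable M"
    and sq: "\<And>k. integrable M (\<lambda>x. (D k x)\<^sup>2)"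
    and orth: "\<And>j k. j < k \<Longrightarrow> (\<integral>x. D j x * D k x \<partial>M) = 0"
    and bound: "\<And>k. (\<integral>x. (D k x)\<^sup>2 \<partial>M) \<le> N"
  shows "AE x in M. (\<lambda>n. (\<Sum>k<n. D k x) / n) \<longlonglongrightarrow> 0"
proof -
  define Q where "Q m x = ((\<Sum>k<m\<^sup>2. D k x)\<^sup>2
      + (\<Sum>j<2 * m + 1. (\<Sum>k\<in>{m\<^sup>2..<m\<^sup>2 + j}. D k x)\<^sup>2)) / real m ^ 4" for m x
  have N: "0 \<le> N"
  proof -
    have "0 \<le> (\<integral>x. (D 0 x)\<^sup>2 \<partial>M)" by simp
    with bound[of 0] show ?thesis by linarith
  qed
  have sq_sum: "integrable M (\<lambda>x. (\<Sum>k\<in>A. D k x)\<^sup>2)" for A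
    using meas sq by (intro square_integrable_sum)
  have var: "(\<integral>x. (\<Sum>k\<in>A. D k x)\<^sup>2 \<partial>M) \<le> N * card A" if "finite A" for A
    using meas sq orth bound that by (rule integral_square_sum_uncorrelated)
  have Q_nonneg: "0 \<le> Q m x" for m x
    unfolding Q_def by (intro divide_nonneg_nonneg add_nonneg_nonneg sum_nonneg) auto
  have Q_int: "integrable M (Q m)" for m
    unfolding Q_def using sq_sum by auto
  have Q_le: "(\<integral>x. Q m x \<partial>M) \<le> 7 * N * (1 / real m ^ 2)" for m
  proof (cases "m = 0")
    case True
    then show ?thesis by (simp add: Q_def)
  next
    case False
    then have m: "real m \<ge> 1" by simp
    have "(\<integral>x. Q m x \<partial>M) = ((\<integral>x. (\<Sum>k<m\<^sup>2. D k x)\<^sup>2 \<partial>M)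
        + (\<Sum>j<2 * m + 1. \<integral>x. (\<Sum>k\<in>{m\<^sup>2..<m\<^sup>2 + j}. D k x)\<^sup>2 \<partial>M)) / real m ^ 4"
      unfolding Q_def using sq_sum by simp
    also have "\<dots> \<le> (N * real m ^ 2 + (\<Sum>j<2 * m + 1. N * (2 * real m))) / real m ^ 4"
    proof (intro divide_right_mono add_mono sum_mono)
      show "(\<integral>x. (\<Sum>k<m\<^sup>2. D k x)\<^sup>2 \<partial>M) \<le> N * real m ^ 2"
        using var[of "{..<m\<^sup>2}"] by simp
      fix j assume "j \<in> {..<2 * m + 1}"
      then have "N * real j \<le> N * (2 * real m)"
        using N by (intro mult_left_mono) auto
      then show "(\<integral>x. (\<Sum>k\<in>{m\<^sup>2..<m\<^sup>2 + j}. D k x)\<^sup>2 \<partial>M) \<le> N * (2 * real m)"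
        using var[of "{m\<^sup>2..<m\<^sup>2 + j}"] by simp
    qed auto
    also have "(\<Sum>j<2 * m + 1. N * (2 * real m)) = N * (4 * real m ^ 2 + 2 * real m)"
      by (simp add: algebra_simps power2_eq_square)
    also have "(N * real m ^ 2 + N * (4 * real m ^ 2 + 2 * real m)) / real m ^ 4
        \<le> (7 * N * real m ^ 2) / real m ^ 4"
    proof (intro divide_right_mono)
      have "N * real m \<le> N * real m ^ 2"
        using m N by (intro mult_left_mono) (auto simp: power2_eq_square)
      then show "N * real m ^ 2 + N * (4 * real m ^ 2 + 2 * real m) \<le> 7 * N * real m ^ 2"
        by (simp add: algebra_simps)
    qed auto
    also have "\<dots> = 7 * N * (1 / real m ^ 2)"
      using m by (simp add: field_simps power4_eq_xxxx power2_eq_square)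
    finally show ?thesis .
  qed
  have "summable (\<lambda>m. 7 * N * (1 / real m ^ 2))"
    by (intro summable_mult) (use inverse_power_summable[of 2, where 'a = real] in
        \<open>simp add: inverse_eq_divide\<close>)
  then have "summable (\<lambda>m. \<integral>x. Q m x \<partial>M)"
    by (rule summable_comparison_test'[where N = 0]) (use Q_le Q_nonneg in auto)
  then have "AE x in M. (\<lambda>m. Q m x) \<longlonglongrightarrow> 0"
    by (intro AE_tendsto_zero_if_summable_integral Q_int Q_nonneg)
  then show ?thesis
  proof eventually_elim
    case (elim x)
    \<comment> \<open>Locate \<open>n\<close> as \<open>m\<^sup>2 + j\<close> with \<open>j \<le> 2m\<close>; both pieces of the sum are controlled by \<open>Q m\<close>.\<close>
    have le: "norm ((\<Sum>k<n. D k x) / n) \<le> 2 * sqrt (Q (floor_sqrt n) x)" if "n \<ge> 1" for n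
    proof -
      define m where "m = floor_sqrt n"
      define j where "j = n - m\<^sup>2"
      have m1: "m \<ge> 1" using that by (simp add: m_def Suc_le_eq)
      have mn: "m\<^sup>2 \<le> n" by (simp add: m_def)
      have n_eq: "n = m\<^sup>2 + j" using mn by (simp add: j_def)
      have "n < (Suc m)\<^sup>2" by (simp add: m_def Suc_floor_sqrt_power2_gt)
      then have j: "j < 2 * m + 1"
        by (simp add: n_eq power2_eq_square)
      have root: "\<bar>a\<bar> \<le> real m ^ 2 * sqrt (Q m x)" if "a\<^sup>2 \<le> real m ^ 4 * Q m x" for a
      proof (rule power2_le_imp_le)
        have "(real m ^ 2 * sqrt (Q m x))\<^sup>2 = real m ^ 4 * (sqrt (Q m x))\<^sup>2"
          unfolding power_mult_distrib by (simp flip: power_mult)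
        with that show "\<bar>a\<bar>\<^sup>2 \<le> (real m ^ 2 * sqrt (Q m x))\<^sup>2"
          using Q_nonneg[of m x] by simp
      qed (simp add: Q_nonneg)
      have Q_eq: "real m ^ 4 * Q m x = (\<Sum>k<m\<^sup>2. D k x)\<^sup>2
          + (\<Sum>j<2 * m + 1. (\<Sum>k\<in>{m\<^sup>2..<m\<^sup>2 + j}. D k x)\<^sup>2)"
        using m1 by (simp add: Q_def)
      have 1: "\<bar>\<Sum>k<m\<^sup>2. D k x\<bar> \<le> real m ^ 2 * sqrt (Q m x)"
        by (rule root) (unfold Q_eq, simp add: sum_nonneg)
      have "(\<Sum>k\<in>{m\<^sup>2..<m\<^sup>2 + j}. D k x)\<^sup>2
          \<le> (\<Sum>j<2 * m + 1. (\<Sum>k\<in>{m\<^sup>2..<m\<^sup>2 + j}. D k x)\<^sup>2)"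
        by (rule member_le_sum) (use j in auto)
      then have 2: "\<bar>\<Sum>k\<in>{m\<^sup>2..<m\<^sup>2 + j}. D k x\<bar> \<le> real m ^ 2 * sqrt (Q m x)"
        by (intro root) (unfold Q_eq, simp add: add_increasing)
      have "(\<Sum>k<n. D k x) = (\<Sum>k<m\<^sup>2. D k x) + (\<Sum>k\<in>{m\<^sup>2..<m\<^sup>2 + j}. D k x)"
        by (simp add: n_eq lessThan_atLeast0 sum.atLeastLessThan_concat)
      then have "\<bar>\<Sum>k<n. D k x\<bar> \<le> 2 * sqrt (Q m x) * real m ^ 2"
        using 1 2 unfolding mult.commute[of "2 * sqrt (Q m x)"] mult.left_commute[of _ 2]
        by linarith
      also have "\<dots> \<le> 2 * sqrt (Q m x) * real n"
        using mn Q_nonneg[of m x] by (intro mult_left_mono) (simp_all flip: of_nat_power)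
      finally show ?thesis
        using that by (simp add: m_def field_simps)
    qed
    have "filterlim floor_sqrt at_top sequentially"
      unfolding filterlim_at_top
    proof
      fix Z
      show "\<forall>\<^sub>F n in sequentially. Z \<le> floor_sqrt n"
        using eventually_ge_at_top[of "Z\<^sup>2"] by eventually_elim (rule le_floor_sqrtI)
    qed
    then have "(\<lambda>n. Q (floor_sqrt n) x) \<longlonglongrightarrow> 0"
      by (rule filterlim_compose[OF elim])
    then have lim: "(\<lambda>n. 2 * sqrt (Q (floor_sqrt n) x)) \<longlonglongrightarrow> 0"
      by (auto intro!: tendsto_eq_intros)
    have "\<forall>\<^sub>F n in sequentially. norm ((\<Sum>k<n. D k x) / n) \<le> 2 * sqrt (Q (floor_sqrt n) x)"
      using eventually_ge_at_top[of 1] by eventually_elim (rule le)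
    then show ?case
      using lim by (rule Lim_null_comparison)
  qed
qed

section \<open>Centering by conditional expectations\<close>

lemma AE_square_real_cond_exp_le:
  fixes Z :: "'a \<Rightarrow> real"
  assumes "prob_space M" "subalgebra M F"
    and Z: "Z \<in> borel_measurable M" "integrable M (\<lambda>x. (Z x)\<^sup>2)"
  shows "AE x in M. (real_cond_exp M F Z x)\<^sup>2 \<le> real_cond_exp M F (\<lambda>x. (Z x)\<^sup>2) x"
proof -
  interpret prob_space M by fact
  interpret finite_measure_subalgebra M F
    by unfold_locales fact
  show ?thesis
    using Z square_integrable_imp_integrable[OF Z]
    by (intro real_cond_exp_jensens_inequality(2)[where I = UNIV]) (auto simp: convex_power2)
qed

text \<open>
  The conditional second moments \<open>V k\<close> are only bounded pathwise, with a random bound. Since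
  \<open>V k\<close> is measurable with respect to \<open>F k\<close>, multiplying the centered variables by the
  indicator of \<open>V k \<le> N\<close> keeps them orthogonal and makes their second moments
  bounded by \<open>4 N\<close>. On the event \<open>\<forall>k. V k \<le> N\<close> nothing is changed, and almost surely one of these
  events, for natural \<open>N\<close>, occurs.
\<close>

theorem strong_law_centered_by_cond_exp:
  fixes Z :: "nat \<Rightarrow> 'a \<Rightarrow> real"
  assumes "prob_space M"
    and sub: "\<And>k. subalgebra M (F k)"
    and mono: "\<And>k. sets (F k) \<subseteq> sets (F (Suc k))"
    and Z: "\<And>k. Z k \<in> borel_measurable (F (Suc k))"
    and sq: "\<And>k. integrable M (\<lambda>x. (Z k x)\<^sup>2)"
    and bdd: "AE x in M. bdd_above (range (\<lambda>k. real_cond_exp M (F k) (\<lambda>y. (Z k y)\<^sup>2) x))"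
  shows "AE x in M. (\<lambda>n. (\<Sum>k<n. Z k x - real_cond_exp M (F k) (Z k) x) / n) \<longlonglongrightarrow> 0"
proof -
  interpret prob_space M by fact
  have sub': "sigma_finite_subalgebra M (F k)" for k
  proof -
    interpret finite_measure_subalgebra M "F k"
      by unfold_locales fact
    show ?thesis by unfold_locales
  qed
  have F_mono: "sets (F j) \<subseteq> sets (F k)" if "j \<le> k" for j k
    using mono that by (rule lift_Suc_mono_le[of "\<lambda>k. sets (F k)"])
  have F_meas: "g \<in> borel_measurable (F k)"
    if "g \<in> borel_measurable (F j)" "j \<le> k" for g :: "'a \<Rightarrow> real" and j k
  proof (rule measurable_from_subalg[OF _ that(1)])
    show "subalgebra (F k) (F j)"
      using sub[of j] sub[of k] F_mono[OF that(2)] by (auto simp: subalgebra_def)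
  qed
  have M_meas: "g \<in> borel_measurable M" if "g \<in> borel_measurable (F k)" for g :: "'a \<Rightarrow> real" and k
    using sub that by (rule measurable_from_subalg)
  define C where "C k = real_cond_exp M (F k) (Z k)" for k
  define V where "V k = real_cond_exp M (F k) (\<lambda>x. (Z k x)\<^sup>2)" for k
  have CF: "C k \<in> borel_measurable (F k)" and VF: "V k \<in> borel_measurable (F k)" for k
    by (auto simp: C_def V_def)
  have ZM: "Z k \<in> borel_measurable M" for k
    by (rule M_meas[OF Z])
  have CM: "C k \<in> borel_measurable M" and VM: "V k \<in> borel_measurable M" for k
    by (rule M_meas[OF CF], rule M_meas[OF VF])
  have V_int: "integrable M (V k)" for k
    unfolding V_def by (rule sigma_finite_subalgebra.real_cond_exp_int(1)[OF sub' sq])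
  have C_le_V: "AE x in M. (C k x)\<^sup>2 \<le> V k x" for k
    unfolding C_def V_def by (rule AE_square_real_cond_exp_le) (use \<open>prob_space M\<close> sub ZM sq in auto)
  have C_sq: "integrable M (\<lambda>x. (C k x)\<^sup>2)" for k
    using C_le_V[of k] CM by (intro Bochner_Integration.integrable_bound[OF V_int[of k]]) auto
  note prod_int = integrable_mult_of_square_integrable

  have "AE x in M. (\<lambda>n. (\<Sum>k<n. of_bool (V k x \<le> real N) * (Z k x - C k x)) / n) \<longlonglongrightarrow> 0" for N :: nat
  proof (rule strong_law_uncorrelated)
    define B where "B k x = (of_bool (V k x \<le> real N) :: real)" for k x
    define D where "D k x = B k x * (Z k x - C k x)" for k x
    have BF: "B k \<in> borel_measurable (F k)" for k
      unfolding B_def using VF[of k] by measurable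
    have BM: "B k \<in> borel_measurable M" for k
      by (rule M_meas[OF BF])
    have B_sq: "integrable M (\<lambda>x. (B k x * g x)\<^sup>2)"
      if "g \<in> borel_measurable M" "integrable M (\<lambda>x. (g x)\<^sup>2)" for g k
    proof (rule Bochner_Integration.integrable_bound[OF that(2)])
      show "(\<lambda>x. (B k x * g x)\<^sup>2) \<in> borel_measurable M"
        using that(1) BM[of k] by measurable
    qed (auto simp: B_def)
    have diff_sq: "integrable M (\<lambda>x. (Z k x - C k x)\<^sup>2)" for k
    proof -
      have "integrable M (\<lambda>x. (Z k x)\<^sup>2 + (C k x)\<^sup>2 - 2 * (Z k x * C k x))"
        using sq C_sq prod_int[OF ZM CM sq C_sq] by simp
      then show ?thesis
        by (simp add: power2_diff mult.assoc)
    qed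
    have DM: "D k \<in> borel_measurable M" for k
      unfolding D_def using BM[of k] ZM[of k] CM[of k] by measurable
    have D_sq: "integrable M (\<lambda>x. (D k x)\<^sup>2)" for k
      unfolding D_def using ZM CM diff_sq by (intro B_sq) auto
    have DF: "D j \<in> borel_measurable (F k)" if "j < k" for j k
    proof -
      have "Z j \<in> borel_measurable (F k)" "B j \<in> borel_measurable (F k)" "C j \<in> borel_measurable (F k)"
        using F_meas[OF Z[of j], of k] F_meas[OF BF[of j], of k] F_meas[OF CF[of j], of k] that by auto
      then show ?thesis
        unfolding D_def by measurable
    qed
    show "(\<lambda>x. of_bool (V k x \<le> real N) * (Z k x - C k x)) \<in> borel_measurable M" for k
      using DM[of k] by (simp add: D_def[abs_def] B_def[abs_def])
    show "integrable M (\<lambda>x. (of_bool (V k x \<le> real N) * (Z k x - C k x))\<^sup>2)" for k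
      using D_sq[of k] by (simp only: D_def[abs_def] B_def[abs_def])
    show "(\<integral>x. of_bool (V j x \<le> real N) * (Z j x - C j x) * (of_bool (V k x \<le> real N) * (Z k x - C k x)) \<partial>M) = 0"
      if "j < k" for j k
    proof -
      have W: "(\<lambda>x. D j x * B k x) \<in> borel_measurable (F k)"
        using DF[OF that] BF[of k] by measurable
      have sqW: "integrable M (\<lambda>x. (D j x * B k x)\<^sup>2)"
        using B_sq[OF DM D_sq, of k j] by (simp add: mult.commute)
      have ZW: "integrable M (\<lambda>x. (D j x * B k x) * Z k x)"
        by (rule prod_int[OF M_meas[OF W] ZM sqW sq])
      have CW: "integrable M (\<lambda>x. (D j x * B k x) * C k x)"
        by (rule prod_int[OF M_meas[OF W] CM sqW C_sq])
      have "(\<integral>x. D j x * D k x \<partial>M) = (\<integral>x. (D j x * B k x) * Z k x - (D j x * B k x) * C k x \<partial>M)"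
        by (simp add: D_def algebra_simps)
      also have "\<dots> = (\<integral>x. (D j x * B k x) * Z k x \<partial>M) - (\<integral>x. (D j x * B k x) * C k x \<partial>M)"
        using ZW CW by (rule Bochner_Integration.integral_diff)
      also have "\<dots> = 0"
        using sigma_finite_subalgebra.real_cond_exp_intg(2)[OF sub' ZW W ZM] by (simp add: C_def)
      finally show ?thesis
        by (simp add: D_def B_def)
    qed
    show "(\<integral>x. (of_bool (V k x \<le> real N) * (Z k x - C k x))\<^sup>2 \<partial>M) \<le> 4 * real N" for k
    proof -
      have B_int: "integrable M (\<lambda>x. B k x * g x)" if "integrable M g" for g
      proof (rule Bochner_Integration.integrable_bound[OF that])
        show "(\<lambda>x. B k x * g x) \<in> borel_measurable M"
          using BM[of k] that by measurable
      qed (auto simp: B_def)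
      have BZ: "integrable M (\<lambda>x. B k x * (Z k x)\<^sup>2)" and BV: "integrable M (\<lambda>x. B k x * V k x)"
        using sq V_int by (auto intro: B_int)
      have "AE x in M. (D k x)\<^sup>2 \<le> 2 * (B k x * (Z k x)\<^sup>2) + 2 * (B k x * V k x)"
        using C_le_V[of k]
      proof eventually_elim
        case (elim x)
        have "0 \<le> (Z k x + C k x)\<^sup>2" by simp
        then have "(Z k x - C k x)\<^sup>2 \<le> 2 * (Z k x)\<^sup>2 + 2 * (C k x)\<^sup>2"
          by (simp add: power2_diff power2_sum)
        with elim show ?case
          by (auto simp: D_def B_def)
      qed
      then have "(\<integral>x. (D k x)\<^sup>2 \<partial>M) \<le> (\<integral>x. 2 * (B k x * (Z k x)\<^sup>2) + 2 * (B k x * V k x) \<partial>M)"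
        using D_sq BZ BV by (intro integral_mono_AE) auto
      also have "\<dots> = 2 * (\<integral>x. B k x * (Z k x)\<^sup>2 \<partial>M) + 2 * (\<integral>x. B k x * V k x \<partial>M)"
        using BZ BV by simp
      also have "(\<integral>x. B k x * (Z k x)\<^sup>2 \<partial>M) = (\<integral>x. B k x * V k x \<partial>M)"
        unfolding V_def using BZ BF ZM
        by (intro sigma_finite_subalgebra.real_cond_exp_intg(2)[OF sub', symmetric]) auto
      also have "2 * (\<integral>x. B k x * V k x \<partial>M) + 2 * (\<integral>x. B k x * V k x \<partial>M) = 4 * (\<integral>x. B k x * V k x \<partial>M)"
        by simp
      also have "(\<integral>x. B k x * V k x \<partial>M) \<le> (\<integral>x. real N \<partial>M)"
        using BV by (intro integral_mono) (auto simp: B_def)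
      finally show ?thesis
        by (simp add: D_def B_def prob_space)
    qed
  qed
  then have "AE x in M. \<forall>N::nat. (\<lambda>n. (\<Sum>k<n. of_bool (V k x \<le> real N) * (Z k x - C k x)) / n) \<longlonglongrightarrow> 0"
    by (simp add: AE_all_countable)
  with bdd show ?thesis
  proof eventually_elim
    case (elim x)
    obtain b where b: "\<And>k. V k x \<le> b"
      using elim(1) by (auto simp: bdd_above_def V_def)
    have "V k x \<le> real (nat \<lceil>b\<rceil>)" for k
      using b[of k] by (meson order_trans real_nat_ceiling_ge)
    then show ?case
      using elim(2)[rule_format, of "nat \<lceil>b\<rceil>"] by (simp add: C_def)
  qed
qed

section \<open>Averages of errors grouped in blocks\<close>

lemma square_le_of_abs_le_sum_abs:
  fixes e :: "'i \<Rightarrow> real"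
  assumes "\<bar>z\<bar> \<le> b * (\<Sum>i\<in>A. \<bar>e i\<bar>)" "card A \<le> L"
  shows "z\<^sup>2 \<le> b\<^sup>2 * real L * (\<Sum>i\<in>A. (e i)\<^sup>2)"
proof -
  have "z\<^sup>2 \<le> (b * (\<Sum>i\<in>A. \<bar>e i\<bar>))\<^sup>2"
    using assms(1) by (rule abs_le_square_iff[THEN iffD1, OF order_trans[OF _ abs_ge_self]])
  also have "\<dots> = b\<^sup>2 * (\<Sum>i\<in>A. \<bar>e i\<bar>)\<^sup>2"
    by (rule power_mult_distrib)
  also have "\<dots> \<le> b\<^sup>2 * ((\<Sum>i\<in>A. \<bar>e i\<bar>\<^sup>2) * real (card A))"
    by (intro mult_left_mono sum_squared_le_sum_of_squares) simp
  also have "\<dots> \<le> b\<^sup>2 * ((\<Sum>i\<in>A. \<bar>e i\<bar>\<^sup>2) * real L)"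
    using assms(2) by (intro mult_left_mono sum_nonneg) auto
  finally show ?thesis
    by (simp add: mult_ac)
qed

lemma integrable_block_square:
  fixes e :: "'i \<Rightarrow> 'a \<Rightarrow> real"
  assumes sq: "\<And>i. i \<in> A \<Longrightarrow> integrable M (\<lambda>x. (e i x)\<^sup>2)"
    and L: "card A \<le> L"
    and Z: "Z \<in> borel_measurable M" "\<And>x. x \<in> space M \<Longrightarrow> \<bar>Z x\<bar> \<le> b * (\<Sum>i\<in>A. \<bar>e i x\<bar>)"
  shows "integrable M (\<lambda>x. (Z x)\<^sup>2)"
proof (rule Bochner_Integration.integrable_bound)
  show "integrable M (\<lambda>x. b\<^sup>2 * real L * (\<Sum>i\<in>A. (e i x)\<^sup>2))"
    using sq by simp
  show "AE x in M. norm ((Z x)\<^sup>2) \<le> norm (b\<^sup>2 * real L * (\<Sum>i\<in>A. (e i x)\<^sup>2))"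
  proof (rule AE_I2)
    fix x assume "x \<in> space M"
    from square_le_of_abs_le_sum_abs[OF Z(2)[OF this] L]
    show "norm ((Z x)\<^sup>2) \<le> norm (b\<^sup>2 * real L * (\<Sum>i\<in>A. (e i x)\<^sup>2))"
      by simp
  qed
qed (use Z(1) in measurable)

text \<open>
  A bound on the conditional second moments of the blocks of errors carries over to every
  sequence that is dominated by the sums of the absolute errors in the blocks. In the two laws
  below, \<open>A k\<close> is the set of indices of the observations of a stage and \<open>F k\<close> is the
  information available before that stage.
\<close>

lemma AE_bdd_above_cond_exp_square:
  fixes e :: "'i \<Rightarrow> 'a \<Rightarrow> real" and A :: "nat \<Rightarrow> 'i set"
  assumes "prob_space M"
    and sub: "\<And>k. subalgebra M (F k)"
    and sq: "\<And>k i. i \<in> A k \<Longrightarrow> integrable M (\<lambda>x. (e i x)\<^sup>2)"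
    and L: "\<And>k. card (A k) \<le> L"
    and bdd: "AE x in M. bdd_above (range (\<lambda>k. real_cond_exp M (F k) (\<lambda>y. \<Sum>i\<in>A k. (e i y)\<^sup>2) x))"
    and Z: "\<And>k. Z k \<in> borel_measurable M"
      "\<And>k x. x \<in> space M \<Longrightarrow> \<bar>Z k x\<bar> \<le> b * (\<Sum>i\<in>A k. \<bar>e i x\<bar>)"
  shows "AE x in M. bdd_above (range (\<lambda>k. real_cond_exp M (F k) (\<lambda>y. (Z k y)\<^sup>2) x))"
proof -
  interpret prob_space M by fact
  let ?E = "\<lambda>k x. real_cond_exp M (F k) (\<lambda>y. \<Sum>i\<in>A k. (e i y)\<^sup>2) x"
  have "AE x in M. real_cond_exp M (F k) (\<lambda>y. (Z k y)\<^sup>2) x \<le> b\<^sup>2 * real L * ?E k x" for k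
  proof -
    interpret finite_measure_subalgebra M "F k"
      by unfold_locales (rule sub)
    have int: "integrable M (\<lambda>y. \<Sum>i\<in>A k. (e i y)\<^sup>2)"
      using sq by simp
    have "AE x in M. real_cond_exp M (F k) (\<lambda>y. (Z k y)\<^sup>2) x
        \<le> real_cond_exp M (F k) (\<lambda>y. b\<^sup>2 * real L * (\<Sum>i\<in>A k. (e i y)\<^sup>2)) x"
    proof (rule real_cond_exp_mono)
      show "AE x in M. (Z k x)\<^sup>2 \<le> b\<^sup>2 * real L * (\<Sum>i\<in>A k. (e i x)\<^sup>2)"
        using square_le_of_abs_le_sum_abs[OF Z(2) L] by (rule AE_I2)
      show "integrable M (\<lambda>y. (Z k y)\<^sup>2)"
        using sq L Z by (rule integrable_block_square)
    qed (use int in simp)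
    with real_cond_exp_cmult[OF int, of "b\<^sup>2 * real L"] show ?thesis
      by eventually_elim simp
  qed
  then have "AE x in M. \<forall>k. real_cond_exp M (F k) (\<lambda>y. (Z k y)\<^sup>2) x \<le> b\<^sup>2 * real L * ?E k x"
    unfolding AE_all_countable by blast
  with bdd show ?thesis
  proof eventually_elim
    case (elim x)
    then obtain C where C: "\<And>k. ?E k x \<le> C"
      by (auto simp: bdd_above_def)
    have "real_cond_exp M (F k) (\<lambda>y. (Z k y)\<^sup>2) x \<le> b\<^sup>2 * real L * C" for k
    proof -
      have "b\<^sup>2 * real L * ?E k x \<le> b\<^sup>2 * real L * C"
        by (intro mult_left_mono C) simp
      with elim(2) show ?thesis
        using order_trans by blast
    qed
    then show ?case
      by (intro bdd_aboveI2)
  qed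
qed

theorem strong_law_weighted_block_errors:
  fixes e w :: "'i \<Rightarrow> 'a \<Rightarrow> real"
  assumes M: "prob_space M"
    and sub: "\<And>k. subalgebra M (F k)"
    and mono: "\<And>k. sets (F k) \<subseteq> sets (F (Suc k))"
    and fin: "\<And>k. finite (A k)" and L: "\<And>k. card (A k) \<le> L"
    and e: "\<And>k i. i \<in> A k \<Longrightarrow> e i \<in> borel_measurable (F (Suc k))"
    and sq: "\<And>k i. i \<in> A k \<Longrightarrow> integrable M (\<lambda>x. (e i x)\<^sup>2)"
    and zero: "\<And>k. AE x in M. \<forall>i\<in>A k. real_cond_exp M (F k) (e i) x = 0"
    and bdd: "AE x in M. bdd_above (range (\<lambda>k. real_cond_exp M (F k) (\<lambda>y. \<Sum>i\<in>A k. (e i y)\<^sup>2) x))"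
    and w: "\<And>k i. i \<in> A k \<Longrightarrow> w i \<in> borel_measurable (F k)"
      "\<And>k i x. i \<in> A k \<Longrightarrow> x \<in> space M \<Longrightarrow> \<bar>w i x\<bar> \<le> b"
  shows "AE x in M. (\<lambda>n. (\<Sum>k<n. \<Sum>i\<in>A k. w i x * e i x) / n) \<longlonglongrightarrow> 0"
proof -
  interpret prob_space M by fact
  define Z where "Z k x = (\<Sum>i\<in>A k. w i x * e i x)" for k x
  have sub_Suc: "subalgebra (F (Suc k)) (F k)" for k
    using sub[of k] sub[of "Suc k"] mono[of k] by (auto simp: subalgebra_def)
  have wS: "w i \<in> borel_measurable (F (Suc k))" if "i \<in> A k" for i k
    using measurable_from_subalg[OF sub_Suc w(1)[OF that]] .
  have ZF: "Z k \<in> borel_measurable (F (Suc k))" for k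
    unfolding Z_def using e wS by (intro borel_measurable_sum borel_measurable_times) auto
  have ZM: "Z k \<in> borel_measurable M" for k
    by (rule measurable_from_subalg[OF sub ZF])
  have Z_le: "\<bar>Z k x\<bar> \<le> b * (\<Sum>i\<in>A k. \<bar>e i x\<bar>)" if "x \<in> space M" for k x
  proof -
    have "\<bar>Z k x\<bar> \<le> (\<Sum>i\<in>A k. \<bar>w i x * e i x\<bar>)"
      unfolding Z_def by (rule sum_abs)
    also have "\<dots> \<le> (\<Sum>i\<in>A k. b * \<bar>e i x\<bar>)"
      unfolding abs_mult using w(2)[OF _ that] by (intro sum_mono mult_right_mono) auto
    finally show ?thesis
      by (simp add: sum_distrib_left)
  qed
  have cond0: "AE x in M. real_cond_exp M (F k) (Z k) x = 0" for k
  proof -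
    interpret finite_measure_subalgebra M "F k"
      by unfold_locales (rule sub)
    have eM: "e i \<in> borel_measurable M" if "i \<in> A k" for i
      using sub e[OF that] by (rule measurable_from_subalg)
    have e_int: "integrable M (e i)" if "i \<in> A k" for i
      using eM[OF that] sq[OF that] by (rule square_integrable_imp_integrable)
    have we_int: "integrable M (\<lambda>x. w i x * e i x)" if "i \<in> A k" for i
    proof (rule Bochner_Integration.integrable_bound)
      show "integrable M (\<lambda>x. b * e i x)"
        using e_int[OF that] by simp
      show "(\<lambda>x. w i x * e i x) \<in> borel_measurable M"
        using eM[OF that] measurable_from_subalg[OF sub w(1)[OF that]] by measurable
      show "AE x in M. norm (w i x * e i x) \<le> norm (b * e i x)"
        using w(2)[OF that] by (intro AE_I2) (force simp: abs_mult intro: mult_right_mono)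
    qed
    \<comment> \<open>The linearity of the conditional expectation over sums asks for integrability at every index.\<close>
    define g where "g i = (if i \<in> A k then (\<lambda>x. w i x * e i x) else (\<lambda>_. 0))" for i
    have "Z k = (\<lambda>x. \<Sum>i\<in>A k. g i x)"
      by (auto simp: Z_def g_def fun_eq_iff intro!: sum.cong)
    moreover have "AE x in M. real_cond_exp M (F k) (\<lambda>x. \<Sum>i\<in>A k. g i x) x
        = (\<Sum>i\<in>A k. real_cond_exp M (F k) (g i) x)"
      by (rule real_cond_exp_sum) (use we_int in \<open>auto simp: g_def\<close>)
    moreover have "AE x in M. \<forall>i\<in>A k. real_cond_exp M (F k) (g i) x = 0"
    proof (rule AE_finite_allI[OF fin])
      fix i assume i: "i \<in> A k"
      have "AE x in M. real_cond_exp M (F k) (\<lambda>x. w i x * e i x) x = w i x * real_cond_exp M (F k) (e i) x"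
        by (rule real_cond_exp_mult[OF w(1)[OF i] eM[OF i] we_int[OF i]])
      with zero[of k] show "AE x in M. real_cond_exp M (F k) (g i) x = 0"
        by eventually_elim (use i in \<open>simp add: g_def\<close>)
    qed
    ultimately show ?thesis
      by auto
  qed
  have "AE x in M. (\<lambda>n. (\<Sum>k<n. Z k x - real_cond_exp M (F k) (Z k) x) / n) \<longlonglongrightarrow> 0"
  proof (rule strong_law_centered_by_cond_exp[where F = F and Z = Z, OF M sub mono ZF])
    show "integrable M (\<lambda>x. (Z k x)\<^sup>2)" for k
      using sq L ZM Z_le by (rule integrable_block_square)
    show "AE x in M. bdd_above (range (\<lambda>k. real_cond_exp M (F k) (\<lambda>y. (Z k y)\<^sup>2) x))"
      by (rule AE_bdd_above_cond_exp_square[OF M sub sq L bdd ZM Z_le])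
  qed
  moreover have "AE x in M. \<forall>k. real_cond_exp M (F k) (Z k) x = 0"
    using cond0 by (simp add: AE_all_countable)
  ultimately show ?thesis
    by eventually_elim (simp add: Z_def)
qed

text \<open>
  The sums of the absolute errors over the blocks are centered by their conditional expectations,
  which are almost surely bounded because their squares are at most the conditional second
  moments of these sums.
\<close>

theorem AE_bounded_averages_abs_block_errors:
  fixes e :: "'i \<Rightarrow> 'a \<Rightarrow> real"
  assumes M: "prob_space M"
    and sub: "\<And>k. subalgebra M (F k)"
    and mono: "\<And>k. sets (F k) \<subseteq> sets (F (Suc k))"
    and L: "\<And>k. card (A k) \<le> L"
    and e: "\<And>k i. i \<in> A k \<Longrightarrow> e i \<in> borel_measurable (F (Suc k))"
    and sq: "\<And>k i. i \<in> A k \<Longrightarrow> integrable M (\<lambda>x. (e i x)\<^sup>2)"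
    and bdd: "AE x in M. bdd_above (range (\<lambda>k. real_cond_exp M (F k) (\<lambda>y. \<Sum>i\<in>A k. (e i y)\<^sup>2) x))"
  shows "AE x in M. \<exists>b. \<forall>n. (\<Sum>k<n. \<Sum>i\<in>A k. \<bar>e i x\<bar>) \<le> b * real n"
proof -
  interpret prob_space M by fact
  define Z where "Z k x = (\<Sum>i\<in>A k. \<bar>e i x\<bar>)" for k x
  have ZF: "Z k \<in> borel_measurable (F (Suc k))" for k
    unfolding Z_def using e by (intro borel_measurable_sum borel_measurable_abs) auto
  have ZM: "Z k \<in> borel_measurable M" for k
    by (rule measurable_from_subalg[OF sub ZF])
  have Z_le: "\<bar>Z k x\<bar> \<le> 1 * (\<Sum>i\<in>A k. \<bar>e i x\<bar>)" for k x
    by (simp add: Z_def sum_nonneg)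
  have Z_sq: "integrable M (\<lambda>x. (Z k x)\<^sup>2)" for k
    using sq L ZM Z_le by (rule integrable_block_square)
  have Z_bdd: "AE x in M. bdd_above (range (\<lambda>k. real_cond_exp M (F k) (\<lambda>y. (Z k y)\<^sup>2) x))"
    by (rule AE_bdd_above_cond_exp_square[OF M sub sq L bdd ZM Z_le])
  have "AE x in M. \<forall>k. (real_cond_exp M (F k) (Z k) x)\<^sup>2 \<le> real_cond_exp M (F k) (\<lambda>y. (Z k y)\<^sup>2) x"
    using AE_square_real_cond_exp_le[OF M sub ZM Z_sq] by (simp add: AE_all_countable)
  with Z_bdd strong_law_centered_by_cond_exp[where F = F and Z = Z, OF M sub mono ZF Z_sq Z_bdd]
  show ?thesis
  proof eventually_elim
    case (elim x)
    let ?C = "\<lambda>k. real_cond_exp M (F k) (Z k) x"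
    obtain V where V: "\<And>k. real_cond_exp M (F k) (\<lambda>y. (Z k y)\<^sup>2) x \<le> V"
      using elim(1) by (auto simp: bdd_above_def)
    have C_le: "?C k \<le> V + 1" for k
    proof -
      have "0 \<le> (?C k - 1)\<^sup>2 + (?C k)\<^sup>2 + 1" by (intro add_nonneg_nonneg) auto
      then have "?C k \<le> (?C k)\<^sup>2 + 1"
        by (simp add: power2_eq_square algebra_simps)
      then show ?thesis
        using elim(3)[rule_format, of k] V[of k] by linarith
    qed
    obtain B where B: "\<And>n. norm ((\<Sum>k<n. Z k x - ?C k) / real n) \<le> B"
      using convergent_imp_Bseq[OF convergentI[OF elim(2)]] by (auto simp: Bseq_def)
    have "(\<Sum>k<n. Z k x) \<le> (B + V + 1) * real n" for n
    proof (cases "n = 0")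
      case False
      have "(\<Sum>k<n. Z k x - ?C k) / real n \<le> B"
        using B[of n] by (metis abs_le_D1 real_norm_def)
      then have "(\<Sum>k<n. Z k x - ?C k) \<le> B * real n"
        using False by (simp add: field_simps)
      moreover have "(\<Sum>k<n. ?C k) \<le> (\<Sum>k<n. V + 1)"
        by (intro sum_mono C_le)
      ultimately show ?thesis
        by (simp add: sum_subtractf algebra_simps)
    qed simp
    then show ?case
      by (auto simp: Z_def)
  qed
qed

section \<open>Uniformity over the parameter space\<close>

text \<open>
  The functions \<open>h(\<cdot>, \<theta>)\<close>, \<open>\<theta> \<in> \<Theta>\<close>, are totally bounded in the supremum norm.
\<close>

lemma finite_uniform_net:
  fixes h :: "'x::metric_space \<Rightarrow> 'th::metric_space \<Rightarrow> real"
  assumes "compact \<X>" "compact \<Theta>"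
    and h: "continuous_on (\<X> \<times> \<Theta>) (\<lambda>(x, \<theta>). h x \<theta>)" and "0 < \<delta>"
  obtains N where "finite N" "N \<subseteq> \<Theta>" "\<And>\<theta>. \<theta> \<in> \<Theta> \<Longrightarrow> \<exists>t\<in>N. \<forall>x\<in>\<X>. \<bar>h x \<theta> - h x t\<bar> < \<delta>"
proof -
  have "uniformly_continuous_on (\<X> \<times> \<Theta>) (\<lambda>(x, \<theta>). h x \<theta>)"
    using h assms(1,2) by (intro compact_uniformly_continuous compact_Times)
  then obtain d where d: "0 < d"
    "\<forall>v\<in>\<X> \<times> \<Theta>. \<forall>w\<in>\<X> \<times> \<Theta>. dist w v < d \<longrightarrow>
      dist ((\<lambda>(x, \<theta>). h x \<theta>) w) ((\<lambda>(x, \<theta>). h x \<theta>) v) < \<delta>"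
    unfolding uniformly_continuous_on_def using \<open>0 < \<delta>\<close> by (elim allE[of _ \<delta>] impE exE conjE)
  obtain N where N: "finite N" "N \<subseteq> \<Theta>" "\<Theta> \<subseteq> (\<Union>t\<in>N. ball t d)"
    using seq_compact_imp_totally_bounded[of \<Theta>] \<open>compact \<Theta>\<close> d(1)
    by (auto simp: compact_eq_seq_compact_metric)
  show thesis
  proof (rule that[OF N(1,2)])
    fix \<theta> assume \<theta>: "\<theta> \<in> \<Theta>"
    then obtain t where t: "t \<in> N" "dist \<theta> t < d"
      using N(3) by (auto simp: dist_commute)
    have "\<bar>h x \<theta> - h x t\<bar> < \<delta>" if "x \<in> \<X>" for x
      using d(2)[THEN bspec, of "(x, t)", THEN bspec, of "(x, \<theta>)"] that \<theta> t N(2)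
      by (auto simp: dist_Pair_Pair dist_real_def)
    with t(1) show "\<exists>t\<in>N. \<forall>x\<in>\<X>. \<bar>h x \<theta> - h x t\<bar> < \<delta>"
      by blast
  qed
qed

lemma countable_uniform_net:
  fixes h :: "'x::metric_space \<Rightarrow> 'th::metric_space \<Rightarrow> real"
  assumes "compact \<X>" "compact \<Theta>" "continuous_on (\<X> \<times> \<Theta>) (\<lambda>(x, \<theta>). h x \<theta>)"
  obtains T where "countable T" "T \<subseteq> \<Theta>"
    "\<And>\<delta>. 0 < \<delta> \<Longrightarrow> \<exists>N\<subseteq>T. finite N \<and> (\<forall>\<theta>\<in>\<Theta>. \<exists>t\<in>N. \<forall>x\<in>\<X>. \<bar>h x \<theta> - h x t\<bar> < \<delta>)"
proof -
  have "\<exists>N. finite N \<and> N \<subseteq> \<Theta> \<and> (\<forall>\<theta>\<in>\<Theta>. \<exists>t\<in>N. \<forall>x\<in>\<X>. \<bar>h x \<theta> - h x t\<bar> < inverse (real (Suc m)))" for m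
    using finite_uniform_net[OF assms, of "inverse (real (Suc m))"]
    by (metis inverse_positive_iff_positive of_nat_0_less_iff zero_less_Suc)
  then obtain N where N: "\<And>m. finite (N m)" "\<And>m. N m \<subseteq> \<Theta>"
    "\<And>m. \<forall>\<theta>\<in>\<Theta>. \<exists>t\<in>N m. \<forall>x\<in>\<X>. \<bar>h x \<theta> - h x t\<bar> < inverse (real (Suc m))"
    by metis
  show thesis
  proof (rule that[of "\<Union>m. N m"])
    show "countable (\<Union>m. N m)"
      using N(1) by (auto intro: countable_finite)
    show "(\<Union>m. N m) \<subseteq> \<Theta>"
      using N(2) by blast
    fix \<delta> :: real assume "0 < \<delta>"
    then obtain m where m: "inverse (real (Suc m)) < \<delta>"
      using reals_Archimedean by blast
    have "\<forall>\<theta>\<in>\<Theta>. \<exists>t\<in>N m. \<forall>x\<in>\<X>. \<bar>h x \<theta> - h x t\<bar> < \<delta>"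
      using N(3)[of m] m by (meson order_less_trans)
    with N(1) show "\<exists>N'\<subseteq>(\<Union>m. N m). finite N' \<and> (\<forall>\<theta>\<in>\<Theta>. \<exists>t\<in>N'. \<forall>x\<in>\<X>. \<bar>h x \<theta> - h x t\<bar> < \<delta>)"
      by (intro exI[of _ "N m"]) auto
  qed
qed

text \<open>
  Convergence of the weighted averages of the errors at the parameters in \<open>T\<close>
  is uniform over \<open>\<Theta>\<close>: replacing \<open>\<theta>\<close> by a point of a finite net changes an average by at most
  the mesh of the net times the average of the absolute errors.
\<close>

lemma uniform_averages_small:
  fixes h :: "'x \<Rightarrow> 'th \<Rightarrow> real" and x :: "nat \<Rightarrow> 'x" and e :: "nat \<Rightarrow> real"
  assumes net: "\<And>\<delta>. 0 < \<delta> \<Longrightarrow> \<exists>N\<subseteq>T. finite N \<and> (\<forall>\<theta>\<in>\<Theta>. \<exists>t\<in>N. \<forall>x\<in>\<X>. \<bar>h x \<theta> - h x t\<bar> < \<delta>)"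
    and x: "\<And>n i. i \<in> A n \<Longrightarrow> x i \<in> \<X>"
    and lim: "\<And>t. t \<in> T \<Longrightarrow> (\<lambda>n. (\<Sum>i\<in>A n. h (x i) t * e i) / real n) \<longlonglongrightarrow> 0"
    and bound: "\<And>n. (\<Sum>i\<in>A n. \<bar>e i\<bar>) \<le> b * real n"
    and "0 < \<delta>"
  shows "\<forall>\<^sub>F n in sequentially. \<forall>\<theta>\<in>\<Theta>. \<bar>\<Sum>i\<in>A n. h (x i) \<theta> * e i\<bar> \<le> \<delta> * real n"
proof -
  define \<eta> where "\<eta> = \<delta> / (2 * (\<bar>b\<bar> + 1))"
  have \<eta>: "0 < \<eta>" "\<eta> * \<bar>b\<bar> \<le> \<delta> / 2"
    using \<open>0 < \<delta>\<close> by (auto simp: \<eta>_def field_simps)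
  obtain N where N: "N \<subseteq> T" "finite N" "\<And>\<theta>. \<theta> \<in> \<Theta> \<Longrightarrow> \<exists>t\<in>N. \<forall>x\<in>\<X>. \<bar>h x \<theta> - h x t\<bar> < \<eta>"
    using net[OF \<eta>(1)] by blast
  have "\<forall>\<^sub>F n in sequentially. \<bar>(\<Sum>i\<in>A n. h (x i) t * e i) / real n\<bar> < \<delta> / 2" if "t \<in> N" for t
    using tendstoD[OF lim[of t], of "\<delta> / 2"] that N(1) \<open>0 < \<delta>\<close> by auto
  then have "\<forall>\<^sub>F n in sequentially. \<forall>t\<in>N. \<bar>(\<Sum>i\<in>A n. h (x i) t * e i) / real n\<bar> < \<delta> / 2"
    using N(2) by (simp add: eventually_ball_finite)
  with eventually_gt_at_top[of 0] show ?thesis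
  proof eventually_elim
    case (elim n)
    show ?case
    proof
      fix \<theta> assume "\<theta> \<in> \<Theta>"
      then obtain t where t: "t \<in> N" "\<And>x. x \<in> \<X> \<Longrightarrow> \<bar>h x \<theta> - h x t\<bar> < \<eta>"
        using N(3) by blast
      have "\<bar>\<Sum>i\<in>A n. h (x i) t * e i\<bar> / real n < \<delta> / 2"
        using elim(2) t(1) by simp
      then have 1: "\<bar>\<Sum>i\<in>A n. h (x i) t * e i\<bar> \<le> \<delta> / 2 * real n"
        using elim(1) by (simp add: field_simps)
      have "\<bar>(\<Sum>i\<in>A n. h (x i) \<theta> * e i) - (\<Sum>i\<in>A n. h (x i) t * e i)\<bar>
          = \<bar>\<Sum>i\<in>A n. (h (x i) \<theta> - h (x i) t) * e i\<bar>"
        by (simp add: sum_subtractf left_diff_distrib)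
      also have "\<dots> \<le> (\<Sum>i\<in>A n. \<bar>(h (x i) \<theta> - h (x i) t) * e i\<bar>)"
        by (rule sum_abs)
      also have "\<dots> \<le> (\<Sum>i\<in>A n. \<eta> * \<bar>e i\<bar>)"
        unfolding abs_mult using t(2)[OF x] by (intro sum_mono mult_right_mono) (auto intro: less_imp_le)
      also have "\<dots> = \<eta> * (\<Sum>i\<in>A n. \<bar>e i\<bar>)"
        by (simp add: sum_distrib_left)
      also have "\<dots> \<le> \<eta> * (\<bar>b\<bar> * real n)"
        using bound[of n] mult_right_mono[OF abs_ge_self[of b], of "real n"] \<eta>(1)
        by (intro mult_left_mono) auto
      also have "\<dots> \<le> \<delta> / 2 * real n"
        using mult_right_mono[OF \<eta>(2), of "real n"] by (simp add: mult.assoc)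
      finally have "\<bar>\<Sum>i\<in>A n. h (x i) \<theta> * e i\<bar> \<le> \<delta> / 2 * real n + \<delta> / 2 * real n"
        using 1 by linarith
      then show "\<bar>\<Sum>i\<in>A n. h (x i) \<theta> * e i\<bar> \<le> \<delta> * real n"
        by simp
    qed
  qed
qed

section \<open>Designs that maximize the determinant\<close>

lemma ex_det_sq_pos_if_span:
  fixes g :: "'x \<Rightarrow> real ^ 'p::finite"
  assumes "span (g ` A) = UNIV"
  obtains z :: "'p \<Rightarrow> 'x" where "\<And>j. z j \<in> A" "0 < det_sq (\<lambda>j. g (z j))"
proof -
  obtain B where B: "B \<subseteq> g ` A" "independent B" "g ` A \<subseteq> span B" "card B = dim (g ` A)"
    using basis_exists[of "g ` A"] by blast
  have "dim (g ` A) = dim (span (g ` A))"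
    by simp
  then have "card B = CARD('p)"
    unfolding B(4) assms by simp
  moreover have "finite B"
    using B(2) by (rule independent_imp_finite)
  ultimately obtain b :: "'p \<Rightarrow> real ^ 'p" where b: "bij_betw b UNIV B"
    using finite_same_card_bij[of "UNIV :: 'p set" B] by auto
  define z where "z j = inv_into A g (b j)" for j
  have "b j \<in> g ` A" for j
    using b B(1) by (auto simp: bij_betw_def)
  then have z: "z j \<in> A" "g (z j) = b j" for j
    by (auto simp: z_def inv_into_into f_inv_into_f)
  let ?A = "\<chi> i j. b j $ i"
  have "columns ?A = range b"
    by (auto simp: columns_def column_def vec_nth_inverse)
  then have "columns ?A = B"
    using b by (simp add: bij_betw_def)
  moreover have "span B = UNIV"
    using B(3) assms by (metis UNIV_I span_minimal subspace_span subsetI subset_antisym)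
  ultimately have "det ?A \<noteq> 0"
    using matrix_right_invertible_span_columns[of ?A] invertible_right_inverse[of ?A]
      invertible_det_nz[of ?A] by (simp add: span_vec_eq)
  then have "0 < det_sq (\<lambda>j. g (z j))"
    by (simp add: det_sq_def z(2))
  with z(1) show ?thesis
    by (rule that)
qed

lemma inj_if_det_sq_pos:
  assumes "0 < det_sq v"
  shows "inj v"
proof (rule injI, rule ccontr)
  fix i j assume *: "v i = v j" "i \<noteq> j"
  have "det (\<chi> i j. v j $ i) = 0"
    by (rule det_identical_columns[OF *(2)]) (simp add: column_def *(1))
  with assms show False
    by (simp add: det_sq_def)
qed

lemma eq_0_if_orthogonal_det_sq_pos:
  fixes v :: "'p::finite \<Rightarrow> real ^ 'p"
  assumes "0 < det_sq v" and "\<And>j. v j \<bullet> w = 0"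
  shows "w = 0"
proof -
  let ?A = "\<chi> i j. v j $ i"
  have "transpose ?A *v w = 0"
    using assms(2) by (simp add: vec_eq_iff matrix_vector_mult_def transpose_def inner_vec_def)
  moreover have "invertible (transpose ?A)"
    using assms(1) by (auto simp: det_sq_def invertible_det_nz)
  ultimately show ?thesis
    using matrix_left_invertible_ker[of "transpose ?A"] by (auto simp: invertible_def)
qed

lemma inj_on_if_deriv_pos:
  fixes G :: "real \<Rightarrow> real"
  assumes I: "is_interval I"
    and G: "G C1_differentiable_on I" "\<And>t. t \<in> I \<Longrightarrow> 0 < deriv G t"
  shows "inj_on G I"
proof (rule linorder_inj_onI')
  fix a b assume ab: "a \<in> I" "b \<in> I" "a < b"
  have "G a < G b"
  proof (rule DERIV_pos_imp_increasing[OF ab(3)])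
    fix x assume "a \<le> x" "x \<le> b"
    then have x: "x \<in> I"
      using mem_is_interval_1_I[OF I ab(1,2)] by simp
    then have "G differentiable at x"
      using G(1) by (auto simp: C1_differentiable_on_eq)
    then have "DERIV G x :> deriv G x"
      by (simp add: DERIV_deriv_iff_real_differentiable)
    with G(2)[OF x] show "\<exists>y. DERIV G x :> y \<and> 0 < y"
      by blast
  qed
  then show "G a \<noteq> G b" by simp
qed

text \<open>
  The only place where the two alternative model assumptions enter: a parameter is determined by
  its responses at \<open>p\<close> design points whose regression vectors, for some parameter \<open>\<theta>1\<close>, are
  linearly independent. Under the first assumption this is because the points are distinct;
  under the second, because \<open>G\<close> is injective and a vector orthogonal to a basis vanishes.
\<close>

lemma parameter_identified_by_independent_design:
  fixes f :: "'th::metric_space \<Rightarrow> 'x::metric_space \<Rightarrow> real ^ 'p::finite" and z :: "'p \<Rightarrow> 'x"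
  assumes cond: "cond_SI TYPE('p) \<X> \<Theta> \<mu> \<or> cond_GLM_star \<X> \<Theta> \<mu> f"
    and z: "\<And>j. z j \<in> \<X>" and \<theta>: "\<theta> \<in> \<Theta>" "\<theta>0 \<in> \<Theta>" "\<theta>1 \<in> \<Theta>"
    and det: "0 < det_sq (\<lambda>j. f \<theta>1 (z j))"
    and eq: "\<And>j. \<mu> (z j) \<theta> = \<mu> (z j) \<theta>0"
  shows "\<theta> = \<theta>0"
  using cond
proof
  assume "cond_SI TYPE('p) \<X> \<Theta> \<mu>"
  moreover have "inj z"
    using inj_if_det_sq_pos[OF det] by (auto simp: inj_def)
  ultimately have "inj_on (\<lambda>\<theta>. (\<chi> j. \<mu> (z j) \<theta>) :: real ^ 'p) \<Theta>"
    using z by (auto simp: cond_SI_def)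
  then show ?thesis
    by (rule inj_onD) (use \<theta> eq in \<open>auto simp: vec_eq_iff\<close>)
next
  assume "cond_GLM_star \<X> \<Theta> \<mu> f"
  then obtain \<psi> :: "'x \<Rightarrow> 'th \<Rightarrow> real" and h :: "'x \<Rightarrow> real ^ 'p" and \<iota> :: "'th \<Rightarrow> real ^ 'p"
      and G :: "real \<Rightarrow> real" and I :: "real set"
    where f: "\<forall>x\<in>\<X>. \<forall>\<theta>\<in>\<Theta>. f \<theta> x = \<psi> x \<theta> *\<^sub>R h x"
      and iso: "\<forall>\<theta>\<in>\<Theta>. \<forall>\<theta>'\<in>\<Theta>. dist (\<iota> \<theta>) (\<iota> \<theta>') = dist \<theta> \<theta>'"
      and I: "is_interval I" "G C1_differentiable_on I" "\<forall>t\<in>I. 0 < deriv G t"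
      and \<mu>: "\<forall>x\<in>\<X>. \<forall>\<theta>\<in>\<Theta>. h x \<bullet> \<iota> \<theta> \<in> I \<and> \<mu> x \<theta> = G (h x \<bullet> \<iota> \<theta>)"
    unfolding cond_GLM_star_def by blast
  have "inj_on G I"
    using I by (intro inj_on_if_deriv_pos) auto
  then have "h (z j) \<bullet> \<iota> \<theta> = h (z j) \<bullet> \<iota> \<theta>0" for j
    by (rule inj_onD) (use \<mu> z[of j] \<theta> eq[of j] in auto)
  then have "f \<theta>1 (z j) \<bullet> (\<iota> \<theta> - \<iota> \<theta>0) = 0" for j
    using f z[of j] \<theta>(3) by (simp add: inner_diff_right)
  then have "\<iota> \<theta> - \<iota> \<theta>0 = 0"
    by (rule eq_0_if_orthogonal_det_sq_pos[OF det])
  with iso \<theta>(1,2) show ?thesis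
    by (metis dist_eq_0_iff right_minus_eq)
qed

lemma compact_functions_with_values_in:
  fixes A :: "'x::metric_space set"
  assumes "compact A"
  shows "compact {z :: 'p::finite \<Rightarrow> 'x. \<forall>j. z j \<in> A}"
proof -
  have "compactin (product_topology (\<lambda>_. euclidean) UNIV) (PiE (UNIV :: 'p set) (\<lambda>_. A))"
    using assms by (simp add: compactin_PiE)
  moreover have "PiE (UNIV :: 'p set) (\<lambda>_. A) = {z. \<forall>j. z j \<in> A}"
    by auto
  ultimately show ?thesis
    by (simp add: euclidean_product_topology)
qed

lemma continuous_on_compose_Pair:
  assumes "continuous_on (\<X> \<times> \<Theta>) h"
    and "continuous_on K a" "continuous_on K b" "\<And>w. w \<in> K \<Longrightarrow> a w \<in> \<X>" "\<And>w. w \<in> K \<Longrightarrow> b w \<in> \<Theta>"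
  shows "continuous_on K (\<lambda>w. h (a w, b w))"
  by (rule continuous_on_compose2[OF assms(1)]) (use assms in \<open>auto intro: continuous_on_Pair\<close>)

lemma continuous_on_det_sq:
  fixes v :: "'c::topological_space \<Rightarrow> 'p::finite \<Rightarrow> real ^ 'p"
  assumes "\<And>j. continuous_on K (\<lambda>w. v w j)"
  shows "continuous_on K (\<lambda>w. det_sq (v w))"
  unfolding det_sq_def det_def using assms by (auto intro!: continuous_intros)

text \<open>
  The triples of a design \<open>z\<close>, a parameter \<open>\<theta>1\<close> for which \<open>z\<close> maximizes the squared
  determinant, and a parameter \<open>\<theta>\<close> at distance at least \<open>\<epsilon>\<close> from \<open>\<theta>0\<close> form a compact set: being a
  maximizer is an intersection of closed conditions. The maximal determinant is not zero, so \<open>z\<close>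
  identifies the parameter, and on this set the sum of squared response differences is a positive
  continuous function.
\<close>

lemma maximal_design_contrast_bounded_below:
  fixes \<mu> :: "'x::metric_space \<Rightarrow> 'th::metric_space \<Rightarrow> real"
    and f :: "'th \<Rightarrow> 'x \<Rightarrow> real ^ 'p::finite"
  assumes "compact \<X>" "compact \<Theta>"
    and \<mu>: "continuous_on (\<X> \<times> \<Theta>) (\<lambda>(x, \<theta>). \<mu> x \<theta>)"
    and f: "continuous_on (\<X> \<times> \<Theta>) (\<lambda>(x, \<theta>). f \<theta> x)"
    and span: "\<And>\<theta>. \<theta> \<in> \<Theta> \<Longrightarrow> span (f \<theta> ` \<X>) = UNIV"
    and \<theta>0: "\<theta>0 \<in> \<Theta>"
    and cond: "cond_SI TYPE('p) \<X> \<Theta> \<mu> \<or> cond_GLM_star \<X> \<Theta> \<mu> f"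
    and "0 < \<epsilon>"
  obtains c where "0 < c"
    "\<And>z \<theta>1 \<theta>. (\<And>j. z j \<in> \<X>) \<Longrightarrow> \<theta>1 \<in> \<Theta> \<Longrightarrow> \<theta> \<in> \<Theta> \<Longrightarrow> \<epsilon> \<le> dist \<theta> \<theta>0 \<Longrightarrow>
      (\<And>z' :: 'p \<Rightarrow> 'x. (\<And>j. z' j \<in> \<X>) \<Longrightarrow> det_sq (\<lambda>j. f \<theta>1 (z' j)) \<le> det_sq (\<lambda>j. f \<theta>1 (z j))) \<Longrightarrow>
      c \<le> (\<Sum>j\<in>UNIV. (\<mu> (z j) \<theta>0 - \<mu> (z j) \<theta>)\<^sup>2)"
proof -
  define Z where "Z = {z :: 'p \<Rightarrow> 'x. \<forall>j. z j \<in> \<X>}"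
  define K where "K = Z \<times> \<Theta> \<times> {\<theta>\<in>\<Theta>. \<epsilon> \<le> dist \<theta> \<theta>0}"
  define m where "m z w = (case w of (_ :: 'p \<Rightarrow> 'x, \<theta>1, _ :: 'th) \<Rightarrow> det_sq (\<lambda>j. f \<theta>1 (z j :: 'x)))" for z w
  define m1 where "m1 w = m (fst w) w" for w
  define contrast where
    "contrast w = (\<Sum>j\<in>UNIV. (\<mu> (fst w j) \<theta>0 - \<mu> (fst w j) (snd (snd w)))\<^sup>2)"
    for w :: "('p \<Rightarrow> 'x) \<times> 'th \<times> 'th"
  define A where "A = K \<inter> (\<Inter>z\<in>Z. {w\<in>K. m z w \<le> m1 w})"
  have coord: "continuous_on K (\<lambda>w. fst w j)" for j
    by (rule continuous_on_compose2[OF continuous_on_product_coordinates continuous_on_fst]) auto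
  have f_cont: "continuous_on K (\<lambda>w. f (fst (snd w)) (a w))"
    if "continuous_on K a" "\<And>w. w \<in> K \<Longrightarrow> a w \<in> \<X>" for a
  proof -
    have "continuous_on K (\<lambda>w. fst (snd w))"
      by (intro continuous_intros)
    from continuous_on_compose_Pair[OF f that(1) this that(2)] show ?thesis
      by (auto simp: K_def)
  qed
  have \<mu>_cont: "continuous_on K (\<lambda>w. \<mu> (fst w j) (b w))"
    if "continuous_on K b" "\<And>w. w \<in> K \<Longrightarrow> b w \<in> \<Theta>" for b j
    using continuous_on_compose_Pair[OF \<mu> coord that(1) _ that(2)]
    by (auto simp: K_def Z_def)
  have "compact Z"
    unfolding Z_def using \<open>compact \<X>\<close> by (rule compact_functions_with_values_in)
  moreover have "compact {\<theta>\<in>\<Theta>. \<epsilon> \<le> dist \<theta> \<theta>0}"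
  proof -
    have "closed {\<theta>. \<epsilon> \<le> dist \<theta> \<theta>0}"
      by (intro closed_Collect_le continuous_intros)
    with \<open>compact \<Theta>\<close> have "compact (\<Theta> \<inter> {\<theta>. \<epsilon> \<le> dist \<theta> \<theta>0})"
      by (rule compact_Int_closed)
    then show ?thesis
      by (simp add: Int_def)
  qed
  ultimately have "compact K"
    unfolding K_def using \<open>compact \<Theta>\<close> by (intro compact_Times)
  moreover have "closed {w\<in>K. m z w \<le> m1 w}" if "z \<in> Z" for z
  proof (rule continuous_on_closed_Collect_le)
    show "closed K"
      using \<open>compact K\<close> by (rule compact_imp_closed)
    show "continuous_on K (m z)"
      unfolding m_def case_prod_unfold
      using that by (intro continuous_on_det_sq f_cont continuous_intros) (auto simp: Z_def)
    show "continuous_on K m1"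
      unfolding m1_def m_def case_prod_unfold
      by (intro continuous_on_det_sq f_cont coord) (auto simp: K_def Z_def)
  qed
  ultimately have "compact A"
    unfolding A_def by (intro compact_Int_closed closed_INT) auto
  have "continuous_on K contrast"
    unfolding contrast_def using \<theta>0
    by (intro continuous_intros \<mu>_cont) (auto simp: K_def)
  then have contrast_cont: "continuous_on A contrast"
    by (rule continuous_on_subset) (auto simp: A_def)
  \<comment> \<open>Positivity: the maximum of the squared determinant is positive, so \<open>z\<close> identifies \<open>\<theta>0\<close>.\<close>
  have pos: "0 < contrast w" if "w \<in> A" for w
  proof -
    obtain z \<theta>1 \<theta> where w: "w = (z, \<theta>1, \<theta>)"
      by (cases w) auto
    have wK: "\<And>j. z j \<in> \<X>" "\<theta>1 \<in> \<Theta>" "\<theta> \<in> \<Theta>" "\<epsilon> \<le> dist \<theta> \<theta>0"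
      using that by (auto simp: A_def K_def Z_def w)
    obtain z' :: "'p \<Rightarrow> 'x" where z': "\<And>j. z' j \<in> \<X>" "0 < det_sq (\<lambda>j. f \<theta>1 (z' j))"
      using ex_det_sq_pos_if_span[OF span[OF wK(2)]] by blast
    moreover have "det_sq (\<lambda>j. f \<theta>1 (z' j)) \<le> det_sq (\<lambda>j. f \<theta>1 (z j))"
      using that z'(1) by (auto simp: A_def m1_def m_def w Z_def)
    ultimately have det: "0 < det_sq (\<lambda>j. f \<theta>1 (z j))"
      by simp
    have "\<theta> \<noteq> \<theta>0"
      using wK(4) \<open>0 < \<epsilon>\<close> by auto
    then obtain j where "\<mu> (z j) \<theta> \<noteq> \<mu> (z j) \<theta>0"
      using parameter_identified_by_independent_design[OF cond wK(1) wK(3) \<theta>0 wK(2) det] by blast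
    then show ?thesis
      unfolding contrast_def w by (intro sum_pos2[of _ j]) auto
  qed
  have "\<exists>c>0. \<forall>w\<in>A. c \<le> contrast w"
  proof (cases "A = {}")
    case False
    then obtain w where "w \<in> A" "\<And>w'. w' \<in> A \<Longrightarrow> contrast w \<le> contrast w'"
      using continuous_attains_inf[OF \<open>compact A\<close> _ contrast_cont] by blast
    with pos show ?thesis by blast
  qed (auto intro: exI[of _ 1])
  then obtain c where c: "0 < c" "\<And>w. w \<in> A \<Longrightarrow> c \<le> contrast w"
    by blast
  show thesis
  proof (rule that[OF c(1)])
    fix z :: "'p \<Rightarrow> 'x" and \<theta>1 \<theta>
    assume *: "\<And>j. z j \<in> \<X>" "\<theta>1 \<in> \<Theta>" "\<theta> \<in> \<Theta>" "\<epsilon> \<le> dist \<theta> \<theta>0"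
      "\<And>z' :: 'p \<Rightarrow> 'x. (\<And>j. z' j \<in> \<X>) \<Longrightarrow> det_sq (\<lambda>j. f \<theta>1 (z' j)) \<le> det_sq (\<lambda>j. f \<theta>1 (z j))"
    then have "(z, \<theta>1, \<theta>) \<in> A"
      by (auto simp: A_def K_def Z_def m1_def m_def)
    from c(2)[OF this] show "c \<le> (\<Sum>j\<in>UNIV. (\<mu> (z j) \<theta>0 - \<mu> (z j) \<theta>)\<^sup>2)"
      by (simp add: contrast_def)
  qed
qed

section \<open>Stages and consistency\<close>

lemma sample_size_Suc:
  "sample_size n1 p (Suc k) = sample_size n1 p k + (if k = 0 then n1 else p)"
  by (cases k) (auto simp: sample_size_def)

lemma sum_over_stages:
  fixes a :: "nat \<Rightarrow> real"
  shows "(\<Sum>i = 1..sample_size n1 p n. a i) = (\<Sum>k<n. \<Sum>i\<in>stage_block n1 p (Suc k). a i)"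
proof (induction n)
  case (Suc n)
  have "(\<Sum>i = 1..sample_size n1 p (Suc n). a i)
      = (\<Sum>i = 1..sample_size n1 p n. a i) + (\<Sum>i\<in>stage_block n1 p (Suc n). a i)"
    unfolding sample_size_Suc[of n1 p n] by (subst sum.ub_add_nat) (auto simp: sample_size_Suc)
  with Suc show ?case by simp
qed (simp add: sample_size_def)

lemma sum_stage_block:
  fixes a :: "nat \<Rightarrow> real"
  assumes "k \<ge> 1"
  shows "(\<Sum>i\<in>stage_block n1 CARD('p) (Suc k). a i)
    = (\<Sum>j\<in>UNIV. a (sample_size n1 CARD('p) k + col_number (j :: 'p::finite)))"
proof -
  have "(\<Sum>i\<in>stage_block n1 CARD('p) (Suc k). a i) = (\<Sum>l\<in>{1..CARD('p)}. a (sample_size n1 CARD('p) k + l))"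
    using assms sum.shift_bounds_cl_nat_ivl[of a 1 "sample_size n1 CARD('p) k" "CARD('p)"]
    by (simp add: sample_size_Suc add.commute)
  also have "\<dots> = (\<Sum>j\<in>UNIV. a (sample_size n1 CARD('p) k + col_number (j :: 'p)))"
    by (rule sum.reindex_bij_betw[OF bij_betw_col_number, symmetric])
  finally show ?thesis .
qed

lemma least_squares_basic_inequality:
  fixes e h :: "nat \<Rightarrow> real"
  assumes "(\<Sum>i\<in>A. (e i + h i)\<^sup>2) \<le> (\<Sum>i\<in>A. (e i)\<^sup>2)"
  shows "(\<Sum>i\<in>A. (h i)\<^sup>2) \<le> 2 * \<bar>\<Sum>i\<in>A. h i * e i\<bar>"
proof -
  have "(\<Sum>i\<in>A. (e i + h i)\<^sup>2) = (\<Sum>i\<in>A. (e i)\<^sup>2) + 2 * (\<Sum>i\<in>A. h i * e i) + (\<Sum>i\<in>A. (h i)\<^sup>2)"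
    by (simp add: power2_sum sum.distrib sum_distrib_left mult_ac)
  with assms show ?thesis by linarith
qed

text \<open>
  The pathwise part of the proof. Here \<open>h x \<theta>\<close> stands for the difference between the true
  response and the response under \<open>\<theta>\<close>. If \<open>\<theta> n\<close> were at distance at least \<open>\<epsilon>\<close> from \<open>\<theta>0\<close>, then each
  of the \<open>n - 1\<close> stages after the first would contribute at least \<open>c\<close> to the sum of the squares
  of \<open>h\<close>, which the basic inequality bounds by twice a sum that is of smaller order than \<open>n\<close>.
\<close>

lemma least_squares_converges:
  fixes h :: "'x \<Rightarrow> 'th::metric_space \<Rightarrow> real" and \<theta> :: "nat \<Rightarrow> 'th"
  assumes \<theta>: "\<And>n. n \<ge> 1 \<Longrightarrow> \<theta> n \<in> \<Theta>"
    and ls: "\<And>n. n \<ge> 1 \<Longrightarrow> (\<Sum>i = 1..sample_size n1 p n. (e i + h (x i) (\<theta> n))\<^sup>2)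
        \<le> (\<Sum>i = 1..sample_size n1 p n. (e i)\<^sup>2)"
    and contrast: "\<And>\<epsilon>. 0 < \<epsilon> \<Longrightarrow> \<exists>c>0. \<forall>k\<ge>1. \<forall>\<theta>\<in>\<Theta>. \<epsilon> \<le> dist \<theta> \<theta>0 \<longrightarrow>
        c \<le> (\<Sum>i\<in>stage_block n1 p (Suc k). (h (x i) \<theta>)\<^sup>2)"
    and small: "\<And>\<delta>. 0 < \<delta> \<Longrightarrow> \<forall>\<^sub>F n in sequentially. \<forall>\<theta>\<in>\<Theta>.
        \<bar>\<Sum>i = 1..sample_size n1 p n. h (x i) \<theta> * e i\<bar> \<le> \<delta> * real n"
  shows "\<theta> \<longlonglongrightarrow> \<theta>0"
proof (rule tendstoI)
  fix \<epsilon> :: real assume "0 < \<epsilon>"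
  from contrast[OF this] obtain c where c: "0 < c" and
    "\<forall>k\<ge>1. \<forall>\<theta>\<in>\<Theta>. \<epsilon> \<le> dist \<theta> \<theta>0 \<longrightarrow> c \<le> (\<Sum>i\<in>stage_block n1 p (Suc k). (h (x i) \<theta>)\<^sup>2)"
    by (elim exE conjE)
  then have c_le: "c \<le> (\<Sum>i\<in>stage_block n1 p (Suc k). (h (x i) \<theta>)\<^sup>2)"
    if "k \<ge> 1" "\<theta> \<in> \<Theta>" "\<epsilon> \<le> dist \<theta> \<theta>0" for k \<theta>
    using that by simp
  \<comment> \<open>With \<open>c / 8\<close>, a violation gives \<open>c (n - 1) \<le> c n / 4\<close>, which is impossible for \<open>n \<ge> 2\<close>.\<close>
  have "0 < c / 8" using c by simp
  from small[OF this] eventually_ge_at_top[of 2]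
  show "\<forall>\<^sub>F n in sequentially. dist (\<theta> n) \<theta>0 < \<epsilon>"
  proof eventually_elim
    case (elim n)
    then have n: "n \<ge> 1" by simp
    show ?case
    proof (rule ccontr)
      assume "\<not> ?thesis"
      then have far: "\<epsilon> \<le> dist (\<theta> n) \<theta>0" by simp
      have "c * (real n - 1) = (\<Sum>k<n. if k = 0 then 0 else c)"
        using n by (cases n) (simp_all add: sum.lessThan_Suc_shift del: sum.lessThan_Suc)
      also have "\<dots> \<le> (\<Sum>k<n. \<Sum>i\<in>stage_block n1 p (Suc k). (h (x i) (\<theta> n))\<^sup>2)"
      proof (rule sum_mono)
        fix k
        show "(if k = 0 then 0 else c) \<le> (\<Sum>i\<in>stage_block n1 p (Suc k). (h (x i) (\<theta> n))\<^sup>2)"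
          using c_le[OF _ \<theta>[OF n] far, of k] by (auto intro: sum_nonneg)
      qed
      also have "\<dots> = (\<Sum>i = 1..sample_size n1 p n. (h (x i) (\<theta> n))\<^sup>2)"
        by (rule sum_over_stages[symmetric])
      also have "\<dots> \<le> 2 * \<bar>\<Sum>i = 1..sample_size n1 p n. h (x i) (\<theta> n) * e i\<bar>"
        by (rule least_squares_basic_inequality[OF ls[OF n]])
      also have "\<dots> \<le> 2 * (c / 8 * real n)"
        using elim(1) \<theta>[OF n] by (intro mult_left_mono) auto
      finally have "c * (real n - 1) \<le> c * (real n / 4)"
        by simp
      then have "real n - 1 \<le> real n / 4"
        using c by (simp only: mult_le_cancel_left_pos)
      with elim(2) show False
        by simp
    qed
  qed
qed

theorem theorem5p1:
  fixes M :: "'w measure" and F :: "nat \<Rightarrow> 'w measure"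
    and \<X> :: "'x::metric_space set" and \<Theta> :: "'th::metric_space set"
    and \<mu> :: "'x \<Rightarrow> 'th \<Rightarrow> real" and f :: "'th \<Rightarrow> 'x \<Rightarrow> real ^ 'p::finite"
    and X :: "nat \<Rightarrow> 'w \<Rightarrow> 'x" and Y e :: "nat \<Rightarrow> 'w \<Rightarrow> real"
    and \<theta>bar :: 'th and \<theta>hat \<theta>LS :: "nat \<Rightarrow> 'w \<Rightarrow> 'th" and n1 :: nat
  assumes "compact \<X>" and "compact \<Theta>"
    and "continuous_on (\<X> \<times> \<Theta>) (\<lambda>(x, \<theta>). \<mu> x \<theta>)"
    and "continuous_on (\<X> \<times> \<Theta>) (\<lambda>(x, \<theta>). f \<theta> x)"
    and "\<And>\<theta>. \<theta> \<in> \<Theta> \<Longrightarrow> span (f \<theta> ` \<X>) = UNIV"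
    and "prob_space M" and "\<theta>bar \<in> \<Theta>" and "n1 \<ge> 1"
    and "\<And>i. i \<ge> 1 \<Longrightarrow> X i \<in> M \<rightarrow>\<^sub>M borel"
    and "\<And>i \<omega>. i \<ge> 1 \<Longrightarrow> \<omega> \<in> space M \<Longrightarrow> X i \<omega> \<in> \<X>"
    and "\<And>i. i \<ge> 1 \<Longrightarrow> Y i \<in> borel_measurable M"
    and "\<And>k. k \<ge> 1 \<Longrightarrow> estimator M \<Theta> X Y (sample_size n1 CARD('p) k) (\<theta>hat k)"
    and "p_step_ahead M \<X> f n1 X \<theta>hat"
    and "\<And>k. k \<ge> 1 \<Longrightarrow> estimator M \<Theta> X Y (sample_size n1 CARD('p) k) (\<theta>LS k)"
    and "\<And>k. k \<ge> 1 \<Longrightarrow> least_squares M \<Theta> \<mu> X Y (sample_size n1 CARD('p) k) (\<theta>LS k)"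
    and "cond_a1 M F n1 CARD('p) X Y"
    and "cond_a2 M F n1 CARD('p) \<mu> \<theta>bar X Y e"
    and "cond_SI TYPE('p) \<X> \<Theta> \<mu> \<or> cond_GLM_star \<X> \<Theta> \<mu> f"
  shows "AE \<omega> in M. (\<lambda>k. \<theta>LS k \<omega>) \<longlonglongrightarrow> \<theta>bar"
proof -
  interpret prob_space M by fact
  let ?n = "sample_size n1 CARD('p)"
  \<comment> \<open>Stages are counted from 1; shifting them makes \<open>F k\<close> the information before stage \<open>Suc k\<close>.\<close>
  define A where "A k = stage_block n1 CARD('p) (Suc k)" for k
  define h where "h x \<theta> = \<mu> x \<theta>bar - \<mu> x \<theta>" for x \<theta>
  have A_ge_1: "i \<ge> 1" if "i \<in> A k" for i k
    using that by (auto simp: A_def)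
  have X_in: "X i \<omega> \<in> \<X>" if "i \<in> A k" "\<omega> \<in> space M" for i k \<omega>
    using assms(10) A_ge_1 that by blast
  have card_A: "card (A k) \<le> n1 + CARD('p)" for k
    by (simp add: A_def sample_size_Suc)
  have sub: "subalgebra M (F k)" and mono: "sets (F k) \<subseteq> sets (F (Suc k))" for k
    using assms(16) by (simp_all add: cond_a1_def)
  have sub_Suc: "subalgebra (F (Suc k)) (F k)" for k
    using sub[of k] sub[of "Suc k"] mono[of k] by (auto simp: subalgebra_def)
  have space_F: "space (F k) = space M" for k
    using sub[of k] by (simp add: subalgebra_def)
  have X_meas: "X i \<in> F k \<rightarrow>\<^sub>M borel" if "i \<in> A k" for i k
  proof -
    have "(\<lambda>\<omega>. \<lambda>i\<in>A k. X i \<omega>) \<in> F k \<rightarrow>\<^sub>M PiM (A k) (\<lambda>_. borel)"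
      using assms(16)[unfolded cond_a1_def, THEN conjunct2, THEN conjunct2, THEN conjunct1,
          rule_format, of "Suc k"] by (simp add: A_def)
    from measurable_compose[OF this measurable_component_singleton[OF that]] show ?thesis
      using that by simp
  qed
  have Y_meas: "Y i \<in> borel_measurable (F (Suc k))" if "i \<in> A k" for i k
  proof -
    have "(\<lambda>\<omega>. \<lambda>i\<in>A k. Y i \<omega>) \<in> F (Suc k) \<rightarrow>\<^sub>M PiM (A k) (\<lambda>_. borel)"
      using assms(16)[unfolded cond_a1_def, THEN conjunct2, THEN conjunct2, THEN conjunct2,
          rule_format, of "Suc k"] by (simp add: A_def)
    from measurable_compose[OF this measurable_component_singleton[OF that]] show ?thesis
      using that by simp
  qed
  have \<mu>_cont: "continuous_on \<X> (\<lambda>x. \<mu> x \<theta>)" if "\<theta> \<in> \<Theta>" for \<theta>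
  proof -
    have "continuous_on \<X> (\<lambda>x. (\<lambda>(x, \<theta>). \<mu> x \<theta>) (x, \<theta>))"
      by (rule continuous_on_compose2[OF assms(3)]) (use that in \<open>auto intro!: continuous_intros\<close>)
    then show ?thesis by simp
  qed
  have comp_meas: "(\<lambda>\<omega>. g (X i \<omega>)) \<in> borel_measurable (F k)"
    if "continuous_on \<X> g" "i \<in> A k" for g :: "'x \<Rightarrow> real" and i k
  proof (rule measurable_compose[OF _ borel_measurable_continuous_on_restrict[OF that(1)]])
    show "X i \<in> F k \<rightarrow>\<^sub>M restrict_space borel \<X>"
      using X_meas[OF that(2)] X_in[OF that(2)]
      by (intro measurable_restrict_space2) (auto simp: space_F)
  qed
  have Y_eq: "Y i \<omega> = \<mu> (X i \<omega>) \<theta>bar + e i \<omega>" if "i \<ge> 1" "\<omega> \<in> space M" for i \<omega>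
    using assms(17) that by (simp add: cond_a2_def)
  have e_meas: "e i \<in> borel_measurable (F (Suc k))" if "i \<in> A k" for i k
  proof -
    have "(\<lambda>\<omega>. Y i \<omega> - \<mu> (X i \<omega>) \<theta>bar) \<in> borel_measurable (F (Suc k))"
      using Y_meas[OF that] measurable_from_subalg[OF sub_Suc comp_meas[OF \<mu>_cont[OF assms(7)] that]]
      by (rule borel_measurable_diff)
    moreover have "e i \<omega> = Y i \<omega> - \<mu> (X i \<omega>) \<theta>bar" if "\<omega> \<in> space (F (Suc k))" for \<omega>
      using Y_eq[of i \<omega>] A_ge_1[OF \<open>i \<in> A k\<close>] that by (simp add: space_F)
    ultimately show ?thesis
      using measurable_cong[of "F (Suc k)" "e i" "\<lambda>\<omega>. Y i \<omega> - \<mu> (X i \<omega>) \<theta>bar" borel] by blast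
  qed
  have e_sq: "integrable M (\<lambda>\<omega>. (e i \<omega>)\<^sup>2)" if "i \<in> A k" for i k
    using assms(17) A_ge_1[OF that] by (simp add: cond_a2_def)
  have e_zero: "AE \<omega> in M. \<forall>i\<in>A k. real_cond_exp M (F k) (e i) \<omega> = 0" for k
    using assms(17)[unfolded cond_a2_def, THEN conjunct2, THEN conjunct2, THEN conjunct1,
        rule_format, of "Suc k"] by (simp add: A_def)
  have e_bdd: "AE \<omega> in M. bdd_above (range (\<lambda>k. real_cond_exp M (F k) (\<lambda>\<omega>'. \<Sum>i\<in>A k. (e i \<omega>')\<^sup>2) \<omega>))"
  proof -
    have *: "{1..} = range Suc"
      by (auto simp: image_iff Suc_le_eq gr0_conv_Suc)
    have "AE \<omega> in M. bdd_above ((\<lambda>k. real_cond_exp M (F (k - 1))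
        (\<lambda>\<omega>'. \<Sum>i\<in>stage_block n1 CARD('p) k. (e i \<omega>')\<^sup>2) \<omega>) ` {1..})"
      using assms(17) by (simp only: cond_a2_def)
    then show ?thesis
      unfolding * image_image A_def by simp
  qed

  have h_cont: "continuous_on (\<X> \<times> \<Theta>) (\<lambda>(x, \<theta>). h x \<theta>)"
  proof -
    have "continuous_on (\<X> \<times> \<Theta>) (\<lambda>w. (\<lambda>x. \<mu> x \<theta>bar) (fst w))"
      by (rule continuous_on_compose2[OF \<mu>_cont[OF assms(7)]]) (auto intro!: continuous_intros)
    from continuous_on_diff[OF this assms(3)] show ?thesis
      by (simp add: h_def case_prod_unfold)
  qed
  obtain T where T: "countable T" "T \<subseteq> \<Theta>"
    "\<And>\<delta>. 0 < \<delta> \<Longrightarrow> \<exists>N\<subseteq>T. finite N \<and> (\<forall>\<theta>\<in>\<Theta>. \<exists>t\<in>N. \<forall>x\<in>\<X>. \<bar>h x \<theta> - h x t\<bar> < \<delta>)"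
    using countable_uniform_net[OF assms(1,2) h_cont] by blast
  have noise: "AE \<omega> in M. (\<lambda>n. (\<Sum>k<n. \<Sum>i\<in>A k. h (X i \<omega>) t * e i \<omega>) / real n) \<longlonglongrightarrow> 0" if "t \<in> T" for t
  proof -
    have cont: "continuous_on \<X> (\<lambda>x. h x t)"
      unfolding h_def using that T(2) assms(7) by (intro continuous_intros \<mu>_cont) auto
    then have "bounded ((\<lambda>x. h x t) ` \<X>)"
      using assms(1) by (intro compact_imp_bounded compact_continuous_image)
    then obtain b where b: "\<And>x. x \<in> \<X> \<Longrightarrow> \<bar>h x t\<bar> \<le> b"
      by (auto simp: bounded_iff)
    show ?thesis
      by (rule strong_law_weighted_block_errors[where F = F and A = A and b = b and L = "n1 + CARD('p)"])
        (use assms(6) sub mono card_A e_meas e_sq e_zero e_bdd comp_meas[OF cont] b X_in in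
          \<open>auto simp: A_def\<close>)
  qed
  have "AE \<omega> in M. \<forall>t\<in>T. (\<lambda>n. (\<Sum>k<n. \<Sum>i\<in>A k. h (X i \<omega>) t * e i \<omega>) / real n) \<longlonglongrightarrow> 0"
    using noise by (simp add: AE_ball_countable[OF T(1)])
  moreover have "AE \<omega> in M. \<exists>b. \<forall>n. (\<Sum>k<n. \<Sum>i\<in>A k. \<bar>e i \<omega>\<bar>) \<le> b * real n"
    by (rule AE_bounded_averages_abs_block_errors[OF assms(6) sub mono card_A e_meas e_sq e_bdd])
  moreover have "AE \<omega> in M. \<omega> \<in> space M"
    by (rule AE_space)
  ultimately show ?thesis
  proof eventually_elim
    case (elim \<omega>)
    obtain b where b: "\<And>n. (\<Sum>k<n. \<Sum>i\<in>A k. \<bar>e i \<omega>\<bar>) \<le> b * real n"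
      using elim(2) by blast
    have est: "\<theta>hat k \<omega> \<in> \<Theta>" "\<theta>LS k \<omega> \<in> \<Theta>" if "k \<ge> 1" for k
      using assms(12)[OF that] assms(14)[OF that] elim(3) by (auto simp: estimator_def)
    show ?case
    proof (rule least_squares_converges[where h = h and e = "\<lambda>i. e i \<omega>" and x = "\<lambda>i. X i \<omega>"
          and \<Theta> = \<Theta> and ?n1.0 = n1 and p = "CARD('p)"])
      fix n :: nat assume n: "n \<ge> 1"
      show "\<theta>LS n \<omega> \<in> \<Theta>"
        by (rule est(2)[OF n])
      have "(\<Sum>i = 1..?n n. (Y i \<omega> - \<mu> (X i \<omega>) (\<theta>LS n \<omega>))\<^sup>2)
          \<le> (\<Sum>i = 1..?n n. (Y i \<omega> - \<mu> (X i \<omega>) \<theta>bar)\<^sup>2)"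
        using assms(15)[OF n] elim(3) assms(7) by (auto simp: least_squares_def)
      then show "(\<Sum>i = 1..?n n. (e i \<omega> + h (X i \<omega>) (\<theta>LS n \<omega>))\<^sup>2) \<le> (\<Sum>i = 1..?n n. (e i \<omega>)\<^sup>2)"
        using Y_eq[OF _ elim(3)] by (simp add: h_def algebra_simps)
    next
      fix \<epsilon> :: real assume "0 < \<epsilon>"
      obtain c where c: "0 < c"
        "\<And>z \<theta>1 \<theta>. (\<And>j. z j \<in> \<X>) \<Longrightarrow> \<theta>1 \<in> \<Theta> \<Longrightarrow> \<theta> \<in> \<Theta> \<Longrightarrow> \<epsilon> \<le> dist \<theta> \<theta>bar \<Longrightarrow>
          (\<And>z' :: 'p \<Rightarrow> 'x. (\<And>j. z' j \<in> \<X>) \<Longrightarrow> det_sq (\<lambda>j. f \<theta>1 (z' j)) \<le> det_sq (\<lambda>j. f \<theta>1 (z j))) \<Longrightarrow>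
          c \<le> (\<Sum>j\<in>UNIV. (\<mu> (z j) \<theta>bar - \<mu> (z j) \<theta>)\<^sup>2)"
        using maximal_design_contrast_bounded_below[OF assms(1-5,7,18) \<open>0 < \<epsilon>\<close>] by blast
      have "c \<le> (\<Sum>i\<in>stage_block n1 CARD('p) (Suc k). (h (X i \<omega>) \<theta>)\<^sup>2)"
        if k: "k \<ge> 1" and \<theta>: "\<theta> \<in> \<Theta>" "\<epsilon> \<le> dist \<theta> \<theta>bar" for k \<theta>
      proof -
        have "X (?n k + col_number (j :: 'p)) \<omega> \<in> \<X>" for j
        proof -
          have "col_number j \<in> {1..CARD('p)}"
            using bij_betwE[OF bij_betw_col_number] by blast
          then show ?thesis
            using elim(3) by (intro assms(10)) auto
        qed
        then have "c \<le> (\<Sum>j\<in>UNIV. (\<mu> (X (?n k + col_number (j :: 'p)) \<omega>) \<theta>bar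
            - \<mu> (X (?n k + col_number j) \<omega>) \<theta>)\<^sup>2)"
          using assms(13) k elim(3)
          by (intro c(2)[of "\<lambda>j. X (?n k + col_number j) \<omega>" "\<theta>hat k \<omega>"] est(1) \<theta>)
            (auto simp: p_step_ahead_def)
        then show ?thesis
          unfolding sum_stage_block[OF k] h_def .
      qed
      with c(1) show "\<exists>c>0. \<forall>k\<ge>1. \<forall>\<theta>\<in>\<Theta>. \<epsilon> \<le> dist \<theta> \<theta>bar \<longrightarrow>
          c \<le> (\<Sum>i\<in>stage_block n1 CARD('p) (Suc k). (h (X i \<omega>) \<theta>)\<^sup>2)"
        by blast
    next
      fix \<delta> :: real assume "0 < \<delta>"
      show "\<forall>\<^sub>F n in sequentially. \<forall>\<theta>\<in>\<Theta>. \<bar>\<Sum>i = 1..?n n. h (X i \<omega>) \<theta> * e i \<omega>\<bar> \<le> \<delta> * real n"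
      proof (rule uniform_averages_small[OF T(3)])
        show "X i \<omega> \<in> \<X>" if "i \<in> {1..?n n}" for i n
          using that elim(3) by (intro assms(10)) auto
        show "(\<lambda>n. (\<Sum>i = 1..?n n. h (X i \<omega>) t * e i \<omega>) / real n) \<longlonglongrightarrow> 0" if "t \<in> T" for t
          using elim(1) that unfolding sum_over_stages A_def by blast
        show "(\<Sum>i = 1..?n n. \<bar>e i \<omega>\<bar>) \<le> b * real n" for n
          using b unfolding sum_over_stages A_def .
      qed (use \<open>0 < \<delta>\<close> in auto)
    qed
  qed
qed

end
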